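(* Let $G=(V,E)$ be an arbitrary $n$-node network graph in which each node has a unique $b=O(\log n)$-bit identifier. There is a deterministic distributed algorithm that computes a network decomposition of $G$ with $O(\log n)$ colors and strong-diameter $O(\log n)$, in $O(\log^8 n)$ rounds of the $\mathsf{LOCAL}$ model.
   Context: The $\mathsf{LOCAL}$ model: the network is the graph $G$ with one processor per node; computation proceeds in synchronous rounds, and per round each node may send one message of unbounded size to each neighbor; initially nodes know only their neighbors and a polynomial upper bound on $n$; at the end each node knows its own color. A network decomposition of $G$ with $c$ colors and strong-diameter $d$ is a partition of $V$ into $c$ disjoint color classes $V_1,\dots,V_c$ such that for each $i$, every connected component of the induced subgraph $G[V_i]$ has diameter (measured within $G[V_i]$) at most $d$. *)

theory Defs
  imports "HOL-Library.Landau_Symbols" "Graph_Theory.Graph_Theory"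
begin

text \<open>
  A finite simple undirected graph is a \<^const>\<open>pair_graph\<close>: each edge is represented by
  its two opposite arcs.  Since all digraphs below are symmetric, their connected components are
  their strongly connected components, given as vertex sets by \<^const>\<open>pre_digraph.sccs_verts\<close>.
\<close>

section \<open>Network decompositions\<close>

text \<open>Hop distances are taken in \<open>H\<close>, not in the subgraph induced by \<open>U\<close>.\<close>

definition diameter_in :: "('a, 'b) pre_digraph \<Rightarrow> 'a set \<Rightarrow> ereal" where
  "diameter_in H U = (SUP u\<in>U. SUP v\<in>U. wf_digraph.\<mu> H (\<lambda>_. 1) u v)"

definition color_class :: "'a pair_pre_digraph \<Rightarrow> ('a \<Rightarrow> nat) \<Rightarrow> nat \<Rightarrow> 'a set" where
  "color_class G f i = {v \<in> pverts G. f v = i}"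

definition network_decomposition ::
    "'a pair_pre_digraph \<Rightarrow> nat \<Rightarrow> nat \<Rightarrow> ('a \<Rightarrow> nat) \<Rightarrow> bool" where
  "network_decomposition G c d f \<longleftrightarrow>
     f ` pverts G \<subseteq> {1..c} \<and>
     (\<forall>i\<in>{1..c}.
        \<forall>U\<in>pre_digraph.sccs_verts (with_proj G \<restriction> color_class G f i).
          diameter_in (with_proj G \<restriction> color_class G f i) U \<le> ereal (real d))"

section \<open>Deterministic algorithms in the LOCAL model\<close>

text \<open>
  \<open>init_state N x X\<close> is the initial state of the node with identifier \<open>x\<close> whose neighbors have
  the set of identifiers \<open>X\<close>, where \<open>N\<close> is the commonly known upper bound on the number of nodes.
  \<open>message s y\<close> is the message, if any, sent in state \<open>s\<close> to the neighbor with identifier \<open>y\<close>.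
  \<open>update s m\<close> is the state reached from \<open>s\<close> when the message received from the neighbor with
  identifier \<open>y\<close> is \<open>m y\<close>.  A node whose \<open>decision\<close> is not \<^const>\<open>None\<close> has terminated with
  that output.  Local computation is unrestricted.
\<close>

record ('s, 'm) local_algorithm =
  init_state :: "nat \<Rightarrow> nat \<Rightarrow> nat set \<Rightarrow> 's"
  message :: "'s \<Rightarrow> nat \<Rightarrow> 'm option"
  update :: "'s \<Rightarrow> (nat \<rightharpoonup> 'm) \<Rightarrow> 's"
  decision :: "'s \<Rightarrow> nat option"

definition neighbors :: "'a pair_pre_digraph \<Rightarrow> 'a \<Rightarrow> 'a set" where
  "neighbors G v = {u. (v, u) \<in> parcs G}"

text \<open>
  The messages reaching \<open>v\<close> in a round started in the global state \<open>\<sigma>\<close>, indexed by the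
  identifier of the sender.  Terminated nodes send nothing.
\<close>

definition inbox ::
    "('s, 'm) local_algorithm \<Rightarrow> 'a pair_pre_digraph \<Rightarrow> ('a \<Rightarrow> nat) \<Rightarrow> ('a \<Rightarrow> 's) \<Rightarrow> 'a
      \<Rightarrow> (nat \<rightharpoonup> 'm)" where
  "inbox A G ident \<sigma> v = (\<lambda>y.
     if y \<in> ident ` neighbors G v
     then let u = the_inv_into (neighbors G v) ident y
          in if decision A (\<sigma> u) = None then message A (\<sigma> u) (ident v) else None
     else None)"

text \<open>The state of each node after a number of synchronous rounds; terminated nodes are frozen.\<close>

primrec run ::
    "('s, 'm) local_algorithm \<Rightarrow> 'a pair_pre_digraph \<Rightarrow> ('a \<Rightarrow> nat) \<Rightarrow> nat \<Rightarrow> nat \<Rightarrow> 'a \<Rightarrow> 's" where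
  "run A G ident N 0 = (\<lambda>v. init_state A N (ident v) (ident ` neighbors G v))"
| "run A G ident N (Suc t) = (\<lambda>v.
     let \<sigma> = run A G ident N t
     in if decision A (\<sigma> v) = None then update A (\<sigma> v) (inbox A G ident \<sigma> v) else \<sigma> v)"

definition computes_within ::
    "('s, 'm) local_algorithm \<Rightarrow> 'a pair_pre_digraph \<Rightarrow> ('a \<Rightarrow> nat) \<Rightarrow> nat \<Rightarrow> nat \<Rightarrow> ('a \<Rightarrow> nat)
      \<Rightarrow> bool" where
  "computes_within A G ident N T f \<longleftrightarrow>
     (\<forall>v\<in>pverts G. decision A (run A G ident N T v) = Some (f v))"

definition bit_identifiers :: "'a pair_pre_digraph \<Rightarrow> nat \<Rightarrow> ('a \<Rightarrow> nat) \<Rightarrow> bool" where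
  "bit_identifiers G b ident \<longleftrightarrow> inj_on ident (pverts G) \<and> (\<forall>v\<in>pverts G. ident v < 2 ^ b)"

end

theory Submission
  imports Defs "HOL-Library.Nat_Bijection"
begin

text \<open>
  Each color is obtained from two ball carvings in the graph induced by the uncolored nodes.
  The weak-diameter carving of Rozhon and Ghaffari runs on the \<open>(2 L + 1)\<close>-th power, where
  \<open>n < 2 ^ L\<close>: in phase \<open>i\<close>, nodes whose label has bit \<open>i\<close> propose to join adjacent clusters
  without it; a cluster either grows by a factor \<open>1 + 1 / (2 b)\<close> or kills its proposers.  At least
  half of the nodes survive, and clusters with different labels have distance more than
  \<open>2 L + 1\<close>.  Sequential ball growing around the survivors of one cluster stops at radius less
  than \<open>L\<close>, so that different clusters do not interfere, and colors at least half as many nodes as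
  there are survivors.  Hence each color takes at least a quarter of the remaining nodes; \<open>3 L\<close> colors
  suffice.

  The color of a node depends on its \<open>O(log\<^sup>8 n)\<close>-ball only: there are \<open>3 L\<close> colors, each with
  \<open>2 b\<^sup>2 L\<close> carving steps, and a step looks at distance \<open>O(b\<^sup>2 L)\<close> in the power graph.  In the
  \<open>LOCAL\<close> model it therefore suffices that every node gathers its ball.
\<close>

section \<open>Ball growing\<close>

text \<open>
  Vertices are the elements of the field.  As every vertex carries a loop, \<open>(R ^^ r) `` {v}\<close> is the
  ball of radius \<open>r\<close> around \<open>v\<close>, and \<open>R ^^ k\<close> is the \<open>k\<close>-th power of the graph.
\<close>

definition fgraph :: "'a rel \<Rightarrow> bool" where
  "fgraph R \<longleftrightarrow> finite R \<and> sym R \<and> (\<forall>x\<in>Field R. (x, x) \<in> R)"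

text \<open>Strong diameter: walks stay inside \<open>M\<close>, and thanks to the loops
  \<open>^^ d\<close> stands for distance at most \<open>d\<close>. The closure is not reflexive, so
  vertices outside \<open>M\<close> contribute no pairs.\<close>

definition components_within :: "nat \<Rightarrow> 'a rel \<Rightarrow> 'a set \<Rightarrow> bool" where
  "components_within d Q M \<longleftrightarrow> (Restr Q M)\<^sup>+ \<subseteq> Restr Q M ^^ d"

section \<open>Powers of finite symmetric relations with loops\<close>

lemma fgraph_finite: "fgraph R \<Longrightarrow> finite R"
  by (simp add: fgraph_def)

lemma fgraph_finite_Field: "fgraph R \<Longrightarrow> finite (Field R)"
  by (simp add: fgraph_def finite_Field)

lemma fgraph_sym: "fgraph R \<Longrightarrow> (x, y) \<in> R \<Longrightarrow> (y, x) \<in> R"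
  by (auto simp: fgraph_def dest: symD)

lemma fgraph_refl: "fgraph R \<Longrightarrow> x \<in> Field R \<Longrightarrow> (x, x) \<in> R"
  by (simp add: fgraph_def)

lemma fgraph_Restr:
  assumes "fgraph R"
  shows "fgraph (Restr R W)" "Field (Restr R W) = Field R \<inter> W"
  using assms by (auto simp: fgraph_def sym_def Field_def Domain_iff Range_iff)

lemma relpow_mono_base:
  fixes P Q :: "'a rel"
  shows "P \<subseteq> Q \<Longrightarrow> P ^^ n \<subseteq> Q ^^ n"
  by (induction n) auto

lemma relpow_relpow: "((R :: 'a rel) ^^ k) ^^ n = R ^^ (n * k)"
  by (induction n) (simp_all add: relpow_add[symmetric] add.commute)

lemma relpow_sym: "sym R \<Longrightarrow> (x, y) \<in> R ^^ n \<Longrightarrow> (y, x) \<in> R ^^ n"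
proof (induction n arbitrary: y)
  case (Suc n)
  then obtain z where "(x, z) \<in> R ^^ n" "(z, y) \<in> R" by auto
  with Suc show ?case by (meson relpow_Suc_I2 symD)
qed auto

lemma relpow_Field:
  assumes "(x, y) \<in> R ^^ n" "x \<in> Field R" shows "y \<in> Field R"
  using assms by (cases n) (auto simp: Field_def)

lemma fgraph_relpow_refl:
  assumes "fgraph R" "x \<in> Field R" shows "(x, x) \<in> R ^^ n"
  using fgraph_refl[OF assms] by (induction n) auto

lemma fgraph_relpow_mono:
  assumes R: "fgraph R" and x: "x \<in> Field R" and xy: "(x, y) \<in> R ^^ m" and mn: "m \<le> n"
  shows "(x, y) \<in> R ^^ n"
proof -
  have "(y, y) \<in> R ^^ (n - m)"
    using fgraph_relpow_refl[OF R] relpow_Field[OF xy x] by blast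
  from relpow_trans[OF xy this] mn show ?thesis by simp
qed

lemma fgraph_relpow:
  assumes "fgraph R" "n > 0"
  shows "fgraph (R ^^ n)" "Field (R ^^ n) = Field R"
proof -
  have symR: "sym (R ^^ n)"
    using relpow_sym[of R] assms(1) by (meson fgraph_def symI)
  have dom: "x \<in> Field R" if "(x, y) \<in> R ^^ n" for x y
    using that assms(2) by (metis FieldI1 gr0_implies_Suc relpow_Suc_D2)
  have sub: "x \<in> Field R" if "x \<in> Field (R ^^ n)" for x
    using that dom symD[OF symR] unfolding Field_def Domain_iff Range_iff Un_iff by metis
  show F: "Field (R ^^ n) = Field R"
    using sub fgraph_relpow_refl[OF assms(1)] by (blast intro: FieldI1)
  show "fgraph (R ^^ n)"
    unfolding fgraph_def F using assms symR fgraph_relpow_refl[OF assms(1)]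
    by (simp add: fgraph_def)
qed

section \<open>Components of bounded strong diameter\<close>

lemma components_within_mono:
  assumes "fgraph Q" "components_within d Q M" "d \<le> d'"
  shows "components_within d' Q M"
  unfolding components_within_def
proof (rule subrelI)
  fix u v assume uv: "(u, v) \<in> (Restr Q M)\<^sup>+"
  then have "u \<in> Field (Restr Q M)" by (metis FieldI1 tranclD)
  with uv assms show "(u, v) \<in> Restr Q M ^^ d'"
    using fgraph_relpow_mono[OF fgraph_Restr(1)[OF assms(1)], of u M v d d']
    by (auto simp: components_within_def)
qed

text \<open>No edge joins pieces with different indices, so a walk in the union never leaves the
  piece in which it starts.\<close>

lemma components_within_UN:
  assumes good: "\<And>i. i \<in> I \<Longrightarrow> components_within d Q (M i)"
    and sep: "\<And>i j u v. i \<in> I \<Longrightarrow> j \<in> I \<Longrightarrow> u \<in> M i \<Longrightarrow> v \<in> M j \<Longrightarrow> (u, v) \<in> Q \<Longrightarrow> i = j"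
  shows "components_within d Q (\<Union>i\<in>I. M i)"
  unfolding components_within_def
proof (rule subrelI)
  let ?P = "Restr Q (\<Union>i\<in>I. M i)"
  fix u v assume uv: "(u, v) \<in> ?P\<^sup>+"
  then obtain i where i: "i \<in> I" "u \<in> M i"
    by (metis (no_types, lifting) IntD2 UN_E mem_Sigma_iff tranclD)
  from uv have "(u, v) \<in> (Restr Q (M i))\<^sup>+ \<and> v \<in> M i"
  proof (induction rule: trancl_induct)
    case (base y)
    then obtain j where "j \<in> I" "y \<in> M j" by auto
    with base i sep[of i j u y] show ?case by auto
  next
    case (step y z)
    then obtain j where "j \<in> I" "z \<in> M j" by auto
    with step i sep[of i j y z] have "(y, z) \<in> Restr Q (M i)" by auto
    with step show ?case by (auto intro: trancl_into_trancl)
  qed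
  with good[OF i(1)] have "(u, v) \<in> Restr Q (M i) ^^ d"
    by (auto simp: components_within_def)
  then show "(u, v) \<in> ?P ^^ d"
    using relpow_mono_base[of "Restr Q (M i)" ?P d] i(1) by auto
qed

text \<open>Each prefix of a walk from the center ends in a smaller ball, so the walk can be taken
  inside the ball; strong diameter needs this.\<close>

lemma relpow_within_ball:
  assumes Q: "fgraph Q" and v: "v \<in> Field Q" and "(v, u) \<in> Q ^^ r"
  shows "(v, u) \<in> Restr Q ((Q ^^ r) `` {v}) ^^ r"
  using assms(3)
proof (induction r arbitrary: u)
  case (Suc r)
  then obtain w where w: "(v, w) \<in> Q ^^ r" "(w, u) \<in> Q" by auto
  let ?B = "\<lambda>r. (Q ^^ r) `` {v}"
  have sub: "?B r \<subseteq> ?B (Suc r)"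
    using fgraph_relpow_mono[OF Q v, of _ r "Suc r"] by auto
  have "(v, w) \<in> Restr Q (?B (Suc r)) ^^ r"
    using Suc.IH[OF w(1)] relpow_mono_base[of "Restr Q (?B r)" "Restr Q (?B (Suc r))" r] sub
    by blast
  moreover have "(w, u) \<in> Restr Q (?B (Suc r))"
    using w sub by auto
  ultimately show ?case by (rule relpow_Suc_I)
qed auto

text \<open>Two vertices of the ball are joined through its center in \<open>r + r\<close> steps,
  padded by loops to \<open>2 * L\<close>.\<close>

lemma components_within_ball:
  assumes Q: "fgraph Q" and v: "v \<in> Field Q" and rL: "r \<le> L"
  shows "components_within (2 * L) Q ((Q ^^ r) `` {v})"
  unfolding components_within_def
proof (rule subrelI)
  let ?P = "Restr Q ((Q ^^ r) `` {v})"
  note P = fgraph_Restr[OF Q, of "(Q ^^ r) `` {v}"]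
  fix u w assume "(u, w) \<in> ?P\<^sup>+"
  then have uw: "u \<in> Field ?P" "w \<in> Field ?P"
    by (metis FieldI1 tranclD, metis FieldI2 tranclD2)
  then have "(v, u) \<in> ?P ^^ r" "(v, w) \<in> ?P ^^ r"
    using relpow_within_ball[OF Q v] P by auto
  then have "(u, w) \<in> ?P ^^ (r + r)"
    using relpow_sym[of ?P v u r] P by (meson fgraph_def relpow_trans)
  then show "(u, w) \<in> ?P ^^ (2 * L)"
    using fgraph_relpow_mono[OF P(1) uw(1), of w "r + r" "2 * L"] rL by simp
qed

text \<open>Otherwise the ball would more than double \<open>L\<close> times and contain at least
  \<open>2 ^ L\<close> vertices.\<close>

lemma ball_growth_stops:
  assumes Q: "fgraph Q" and v: "v \<in> Field Q" and n: "card (Field Q) < 2 ^ L"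
  shows "\<exists>r<L. card ((Q ^^ Suc r) `` {v}) \<le> 2 * card ((Q ^^ r) `` {v})"
proof (rule ccontr)
  assume neg: "\<not> ?thesis"
  have "r \<le> L \<Longrightarrow> 2 ^ r \<le> card ((Q ^^ r) `` {v})" for r
  proof (induction r)
    case (Suc r)
    with neg have "2 * card ((Q ^^ r) `` {v}) < card ((Q ^^ Suc r) `` {v})"
      by (simp add: not_le)
    with Suc show ?case by simp
  qed simp
  then have "2 ^ L \<le> card ((Q ^^ L) `` {v})" by simp
  also have "\<dots> \<le> card (Field Q)"
    using relpow_Field[of v _ L Q] v by (intro card_mono fgraph_finite_Field[OF Q]) auto
  finally show False using n by simp
qed

text \<open>Induction on \<open>card C\<close>: a ball around a vertex of \<open>C\<close> is grown
  until its next step at most doubles it, and the rest of \<open>C\<close> is treated in the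
  remaining graph. \<open>M\<close> may contain vertices outside \<open>C\<close>, so the kept ball
  pays for every vertex of \<open>C\<close> that is lost with the larger ball.\<close>

lemma ball_carving:
  assumes "fgraph Q" "card (Field Q) < 2 ^ L" "C \<subseteq> Field Q"
  shows "\<exists>M \<subseteq> (Q ^^ L) `` C. card C \<le> 2 * card M \<and> components_within (2 * L) Q M"
  using assms
proof (induction "card C" arbitrary: Q C rule: less_induct)
  case less
  note Q = less.prems(1) and n = less.prems(2) and CQ = less.prems(3)
  note finQ = fgraph_finite_Field[OF Q]
  have finC: "finite C" using CQ finQ by (rule finite_subset)
  show ?case
  proof (cases "C = {}")
    case True
    then show ?thesis by (auto simp: components_within_def)
  next
    case False
    then obtain v where v: "v \<in> C" by auto
    with CQ have vQ: "v \<in> Field Q" by auto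
    define B where "B r = (Q ^^ r) `` {v}" for r
    obtain r where r: "r < L" "card (B (Suc r)) \<le> 2 * card (B r)"
      using ball_growth_stops[OF Q vQ n] by (auto simp: B_def)
    have BQ: "B s \<subseteq> Field Q" for s
      using relpow_Field[of v _ s Q] vQ by (auto simp: B_def)
    have finB: "finite (B s)" for s
      using BQ finQ by (rule finite_subset)
    have Bmono: "B s \<subseteq> B t" if "s \<le> t" for s t
      using fgraph_relpow_mono[OF Q vQ _ that] by (auto simp: B_def)
    have vB: "v \<in> B s" for s
      using fgraph_relpow_refl[OF Q vQ] by (auto simp: B_def)
    \<comment> \<open>The larger ball is deleted but only \<open>B r\<close> is kept: the outer
      layer separates it from everything chosen later.\<close>
    let ?W = "Field Q - B (Suc r)"
    define Q' where "Q' = Restr Q ?W"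
    define C' where "C' = C - B (Suc r)"
    have Q': "fgraph Q'" "Field Q' = ?W"
      using fgraph_Restr[OF Q, of ?W] by (auto simp: Q'_def)
    have "card C' < card C"
      using v vB finC unfolding C'_def by (intro psubset_card_mono) auto
    moreover have "card (Field Q') < 2 ^ L"
      using card_mono[OF finQ, of "Field Q'"] n Q' by auto
    moreover have "C' \<subseteq> Field Q'"
      using CQ Q' by (auto simp: C'_def)
    ultimately obtain M' where M': "M' \<subseteq> (Q' ^^ L) `` C'" "card C' \<le> 2 * card M'"
        "components_within (2 * L) Q' M'"
      using less.hyps[of C' Q'] Q'(1) by auto
    have M'W: "M' \<subseteq> ?W"
      using M'(1) \<open>C' \<subseteq> Field Q'\<close> relpow_Field[of _ _ L Q'] Q'(2) by blast
    then have fin': "finite M'" using finQ by (blast intro: finite_subset)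
    have "M' \<inter> B r = {}" using M'W Bmono[of r "Suc r"] by auto
    then have cardM: "card (B r \<union> M') = card (B r) + card M'"
      using finB fin' by (simp add: card_Un_disjoint Int_commute)
    have "card C \<le> card (B (Suc r)) + card C'"
      using card_mono[of "B (Suc r) \<union> C'" C] finB finC card_Un_le[of "B (Suc r)" C']
      by (auto simp: C'_def)
    then have "card C \<le> 2 * card (B r \<union> M')"
      using r(2) M'(2) cardM by simp
    moreover have "B r \<union> M' \<subseteq> (Q ^^ L) `` C"
    proof
      fix x assume "x \<in> B r \<union> M'"
      then show "x \<in> (Q ^^ L) `` C"
      proof
        assume "x \<in> B r"
        with Bmono[of r L] r v show ?thesis by (auto simp: B_def)
      next
        assume "x \<in> M'"
        with M'(1) relpow_mono_base[of Q' Q L] show ?thesis by (auto simp: Q'_def C'_def)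
      qed
    qed
    moreover have "components_within (2 * L) Q (B r \<union> M')"
    proof -
      let ?M = "\<lambda>b. if b then B r else M'"
      have "Restr Q' M' = Restr Q M'" using M'W by (auto simp: Q'_def)
      with M'(3) have "components_within (2 * L) Q M'"
        by (simp add: components_within_def)
      moreover have "components_within (2 * L) Q (B r)"
        using components_within_ball[OF Q vQ, of r L] r by (simp add: B_def)
      moreover have "\<not> (x \<in> B r \<and> y \<in> M' \<and> ((x, y) \<in> Q \<or> (y, x) \<in> Q))" for x y
        using M'W fgraph_sym[OF Q] by (auto simp: B_def)
      ultimately have "components_within (2 * L) Q (\<Union>b\<in>UNIV. ?M b)"
        by (intro components_within_UN) (auto split: if_splits)
      moreover have "(\<Union>b\<in>UNIV. ?M b) = B r \<union> M'"
        by (auto split: if_splits)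
      ultimately show ?thesis by simp
    qed
    ultimately show ?thesis by blast
  qed
qed

section \<open>Weak-diameter carving\<close>

text \<open>The least label breaks ties by a rule that depends on the neighborhood alone, as
  locality requires.\<close>

definition proposal :: "nat \<Rightarrow> nat rel \<Rightarrow> (nat \<rightharpoonup> nat) \<Rightarrow> (nat \<rightharpoonup> nat)" where
  "proposal i H lab v =
     (if (\<exists>x. lab v = Some x \<and> bit x i) \<and> (\<exists>u y. (v, u) \<in> H \<and> lab u = Some y \<and> \<not> bit y i)
      then Some (LEAST y. \<not> bit y i \<and> (\<exists>u. (v, u) \<in> H \<and> lab u = Some y)) else None)"

text \<open>
  \<open>A v\<close> is the part of the graph that \<open>v\<close> inspects when counting.  The analysis uses the whole
  graph, the algorithm a ball that is large enough to contain the relevant clusters.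
\<close>

definition carve_step ::
    "nat \<Rightarrow> nat \<Rightarrow> nat rel \<Rightarrow> (nat \<Rightarrow> nat set) \<Rightarrow> (nat \<rightharpoonup> nat) \<Rightarrow> (nat \<rightharpoonup> nat)" where
  "carve_step b i H A lab v =
     (case proposal i H lab v of None \<Rightarrow> lab v
      | Some y \<Rightarrow>
          if card {u \<in> A v. lab u = Some y} \<le> 2 * b * card {u \<in> A v. proposal i H lab u = Some y}
          then Some y else None)"

text \<open>No one-bit node touches such a cluster, so nobody proposes to it. A zero-bit label once
  closed stays closed during the phase.\<close>

definition closed_label :: "nat \<Rightarrow> nat rel \<Rightarrow> (nat \<rightharpoonup> nat) \<Rightarrow> nat \<Rightarrow> bool" where
  "closed_label i H lab y \<longleftrightarrow>
     (\<forall>u v x. lab u = Some y \<longrightarrow> (u, v) \<in> H \<longrightarrow> lab v = Some x \<longrightarrow> \<not> bit x i)"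

text \<open>The number of these nodes is the potential that pays for killed nodes.\<close>

definition closed_nodes :: "nat \<Rightarrow> nat rel \<Rightarrow> (nat \<rightharpoonup> nat) \<Rightarrow> nat set" where
  "closed_nodes i H lab = {v. \<exists>y. lab v = Some y \<and> \<not> bit y i \<and> closed_label i H lab y}"

text \<open>The invariant between phases: once \<open>i\<close> reaches the identifier length,
  adjacent living nodes carry equal labels.\<close>

definition low_bits_agree :: "nat \<Rightarrow> nat rel \<Rightarrow> (nat \<rightharpoonup> nat) \<Rightarrow> bool" where
  "low_bits_agree i H lab \<longleftrightarrow>
     (\<forall>u v x y. (u, v) \<in> H \<longrightarrow> lab u = Some x \<longrightarrow> lab v = Some y \<longrightarrow> (\<forall>k<i. bit x k = bit y k))"

abbreviation cluster :: "('a \<rightharpoonup> 'b) \<Rightarrow> 'b \<Rightarrow> 'a set" where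
  "cluster f y \<equiv> {v. f v = Some y}"

section \<open>Elementary properties of one carving step\<close>

lemma proposal_SomeD:
  assumes "proposal i H lab v = Some y"
  obtains x u where "lab v = Some x" "bit x i" "\<not> bit y i" "(v, u) \<in> H" "lab u = Some y"
proof -
  from assms obtain x u' y' where x: "lab v = Some x" "bit x i"
    and u': "(v, u') \<in> H" "lab u' = Some y'" "\<not> bit y' i"
    and y: "y = (LEAST y. \<not> bit y i \<and> (\<exists>u. (v, u) \<in> H \<and> lab u = Some y))"
    by (auto simp: proposal_def split: if_splits)
  have "\<not> bit y i \<and> (\<exists>u. (v, u) \<in> H \<and> lab u = Some y)"
    unfolding y by (rule LeastI[of _ y']) (use u' in blast)
  with x that show ?thesis by blast
qed

lemma proposal_eq_None_iff:
  "proposal i H lab v = None \<longleftrightarrow>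
     \<not> ((\<exists>x. lab v = Some x \<and> bit x i) \<and> (\<exists>u y. (v, u) \<in> H \<and> lab u = Some y \<and> \<not> bit y i))"
  by (auto simp: proposal_def)

lemma carve_step_SomeD:
  assumes "carve_step b i H A lab v = Some y"
  shows "lab v = Some y \<and> proposal i H lab v = None \<or> proposal i H lab v = Some y"
  using assms by (auto simp: carve_step_def split: option.splits if_splits)

lemma dom_carve_step: "dom (carve_step b i H A lab) \<subseteq> dom lab"
  by (force dest!: carve_step_SomeD elim: proposal_SomeD)

lemma carve_step_zero_bit:
  "lab v = Some y \<Longrightarrow> \<not> bit y i \<Longrightarrow> carve_step b i H A lab v = Some y"
  by (auto simp: carve_step_def proposal_def)

text \<open>Proposers die or obtain a zero-bit label. A node with a one-bit label after the step
  therefore did not propose, so it had no zero-bit neighbor before the step.\<close>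

lemma carve_step_one_bit:
  assumes "carve_step b i H A lab v = Some x" "bit x i"
  shows "lab v = Some x" "(v, u) \<in> H \<Longrightarrow> lab u = Some y \<Longrightarrow> bit y i"
  using carve_step_SomeD[OF assms(1)] assms(2)
  by (auto elim: proposal_SomeD simp: proposal_eq_None_iff)

text \<open>A node only ever adopts the label of a neighbor, with which it agrees on the low bits
  already; so its own low bits do not change.\<close>

lemma low_bits_agree_carve_step:
  assumes "low_bits_agree i H lab"
  shows "low_bits_agree i H (carve_step b i H A lab)"
proof -
  have *: "\<exists>x'. lab v = Some x' \<and> (\<forall>k<i. bit x' k = bit x k)"
    if "carve_step b i H A lab v = Some x" for v x
    using carve_step_SomeD[OF that]
  proof
    assume "proposal i H lab v = Some x"
    then obtain x' u where "lab v = Some x'" "(v, u) \<in> H" "lab u = Some x"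
      by (rule proposal_SomeD)
    with assms show ?thesis unfolding low_bits_agree_def by blast
  qed auto
  show ?thesis unfolding low_bits_agree_def
  proof (intro allI impI)
    fix u v x y k
    assume uv: "(u, v) \<in> H" and "carve_step b i H A lab u = Some x"
      "carve_step b i H A lab v = Some y" and k: "k < i"
    with * obtain x' y' where
      "lab u = Some x'" "\<forall>k<i. bit x' k = bit x k" "lab v = Some y'" "\<forall>k<i. bit y' k = bit y k"
      by metis
    with assms uv k show "bit x k = bit y k" unfolding low_bits_agree_def by metis
  qed
qed

section \<open>Growth and deaths in one step with global counting\<close>

context
  fixes H :: "nat rel" and b i :: nat and lab lab' :: "nat \<rightharpoonup> nat"
  assumes H: "fgraph H" and b: "0 < b" and domH: "dom lab \<subseteq> Field H"
    and step: "lab' = carve_step b i H (\<lambda>_. UNIV) lab"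
begin

lemma finite_dom_lab: "finite (dom lab)"
  using domH fgraph_finite_Field[OF H] by (rule finite_subset)

lemma finite_cluster: "finite (cluster lab y)" "finite (cluster (proposal i H lab) y)"
  by (rule finite_subset[OF _ finite_dom_lab]; auto elim: proposal_SomeD)+

text \<open>With global counting the test for \<open>y\<close> gives the same answer to every
  proposer, so the cluster accepts all or none of them; zero-bit nodes never leave.\<close>

lemma cluster_step:
  assumes "\<not> bit y i"
  shows "cluster lab' y =
    (if card (cluster lab y) \<le> 2 * b * card (cluster (proposal i H lab) y)
     then cluster lab y \<union> cluster (proposal i H lab) y else cluster lab y)"
proof -
  have "lab' v = Some y \<longleftrightarrow> lab v = Some y \<or> proposal i H lab v = Some y \<and>
      card (cluster lab y) \<le> 2 * b * card (cluster (proposal i H lab) y)" for v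
  proof (cases "proposal i H lab v")
    case None
    then show ?thesis by (simp add: step carve_step_def)
  next
    case (Some z)
    have "lab v \<noteq> Some y" using proposal_SomeD[OF Some] assms by force
    with Some show ?thesis by (auto simp: step carve_step_def)
  qed
  then show ?thesis by auto
qed

lemma closed_label_cluster_step:
  assumes "\<not> bit y i" "closed_label i H lab y"
  shows "cluster lab' y = cluster lab y"
proof -
  have "cluster (proposal i H lab) y = {}"
    using assms(2) fgraph_sym[OF H] unfolding closed_label_def
    by (auto elim!: proposal_SomeD)
  with cluster_step[OF assms(1)] show ?thesis by simp
qed

text \<open>Every one-bit neighbor of the old cluster proposes to some zero-bit label and so loses
  its own. One-bit neighbors after the step could only be adjacent to new members, and there are
  none.\<close>

lemma cluster_unchanged_closed_label:
  assumes "\<not> bit y i" "cluster lab' y = cluster lab y"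
  shows "closed_label i H lab' y"
  unfolding closed_label_def
proof (intro allI impI notI)
  fix u v x assume "lab' u = Some y" "(u, v) \<in> H" "lab' v = Some x" "bit x i"
  moreover from this assms have "lab u = Some y" by blast
  ultimately show False
    using carve_step_one_bit(2)[of b i H "\<lambda>_. UNIV" lab v x u y] fgraph_sym[OF H] assms(1) step
    by blast
qed

text \<open>A cluster that remains open must have changed, hence accepted its proposers, who number
  at least a fraction \<open>1 / (2 * b)\<close> of it. The growth factor is stated with cleared
  denominators.\<close>

lemma open_label_growth:
  assumes y: "\<not> bit y i" and ne: "lab' v = Some y" and op: "\<not> closed_label i H lab' y"
  shows "\<not> closed_label i H lab y" "\<exists>u. lab u = Some y"
    "(2 * b + 1) * card (cluster lab y) \<le> 2 * b * card (cluster lab' y)"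
proof -
  show "\<not> closed_label i H lab y"
    using closed_label_cluster_step cluster_unchanged_closed_label y op by blast
  show "\<exists>u. lab u = Some y"
    using ne carve_step_SomeD[of b i H "\<lambda>_. UNIV" lab v y] by (auto simp: step elim: proposal_SomeD)
  let ?P = "cluster (proposal i H lab) y"
  have changed: "cluster lab' y \<noteq> cluster lab y"
    using cluster_unchanged_closed_label y op by blast
  then have c: "card (cluster lab y) \<le> 2 * b * card ?P"
    and eq: "cluster lab' y = cluster lab y \<union> ?P"
    using cluster_step[OF y] by (auto split: if_splits)
  have "cluster lab y \<inter> ?P = {}"
    using y by (auto elim!: proposal_SomeD)
  then have "card (cluster lab' y) = card (cluster lab y) + card ?P"
    unfolding eq using finite_cluster by (intro card_Un_disjoint) auto
  then show "(2 * b + 1) * card (cluster lab y) \<le> 2 * b * card (cluster lab' y)"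
    using c by (simp add: algebra_simps)
qed

text \<open>
  A cluster kills its proposers at most once per phase: it becomes closed by doing so.  Hence the
  deaths can be charged to the nodes of closed clusters.
\<close>

lemma deaths_charged:
  "2 * b * card (dom lab - dom lab') + card (closed_nodes i H lab) \<le> card (closed_nodes i H lab')"
proof -
  let ?P = "cluster (proposal i H lab)" and ?A = "cluster lab"
  \<comment> \<open>The labels that kill in this step. Demanding a proposer excludes clusters to
    which nobody proposes, which would satisfy the inequality trivially.\<close>
  define Y where "Y = {y. ?P y \<noteq> {} \<and> 2 * b * card (?P y) < card (?A y)}"
  have Y0: "\<not> bit y i" if "y \<in> Y" for y
    using that by (auto simp: Y_def elim: proposal_SomeD)
  have finY: "finite Y"
  proof -
    have "Y \<subseteq> the ` lab ` dom lab"
      by (force simp: Y_def elim!: proposal_SomeD)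
    then show ?thesis using finite_dom_lab by (blast intro: finite_subset)
  qed
  have "dom lab - dom lab' \<subseteq> (\<Union>y\<in>Y. ?P y)"
  proof
    fix v assume v: "v \<in> dom lab - dom lab'"
    then obtain y where "proposal i H lab v = Some y"
      and "\<not> card (?A y) \<le> 2 * b * card (?P y)"
      by (auto simp: step carve_step_def split: option.splits if_splits)
    then show "v \<in> (\<Union>y\<in>Y. ?P y)" by (auto simp: Y_def)
  qed
  then have "card (dom lab - dom lab') \<le> card (\<Union>y\<in>Y. ?P y)"
    using finY finite_cluster by (intro card_mono) auto
  also have "\<dots> \<le> (\<Sum>y\<in>Y. card (?P y))"
    using finY by (rule card_UN_le)
  finally have "2 * b * card (dom lab - dom lab') \<le> (\<Sum>y\<in>Y. 2 * b * card (?P y))"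
    using b by (simp add: sum_distrib_left[symmetric])
  also have "\<dots> \<le> (\<Sum>y\<in>Y. card (?A y))"
    by (intro sum_mono) (auto simp: Y_def)
  also have "\<dots> = card (\<Union>y\<in>Y. ?A y)"
    using finY finite_cluster by (intro card_UN_disjoint[symmetric]) auto
  finally have 1: "2 * b * card (dom lab - dom lab') \<le> card (\<Union>y\<in>Y. ?A y)" .
  have same: "cluster lab' y = ?A y" if "y \<in> Y" for y
    using cluster_step[OF Y0[OF that]] that by (auto simp: Y_def)
  have "(\<Union>y\<in>Y. ?A y) \<subseteq> closed_nodes i H lab'"
  proof
    fix v assume "v \<in> (\<Union>y\<in>Y. ?A y)"
    then obtain y where y: "y \<in> Y" "v \<in> ?A y" by auto
    with same have "lab' v = Some y" by blast
    with y show "v \<in> closed_nodes i H lab'"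
      using Y0 same cluster_unchanged_closed_label by (auto simp: closed_nodes_def)
  qed
  moreover have "closed_nodes i H lab \<subseteq> closed_nodes i H lab'"
  proof
    fix v assume "v \<in> closed_nodes i H lab"
    then obtain y where y: "lab v = Some y" "\<not> bit y i" "closed_label i H lab y"
      by (auto simp: closed_nodes_def)
    then show "v \<in> closed_nodes i H lab'"
      using closed_label_cluster_step[OF y(2,3)] cluster_unchanged_closed_label[OF y(2)]
        carve_step_zero_bit[of lab v y i b H] by (auto simp: closed_nodes_def step)
  qed
  \<comment> \<open>The charge is fresh: a cluster closed before the step has no proposers and
    cannot kill.\<close>
  moreover have "(\<Union>y\<in>Y. ?A y) \<inter> closed_nodes i H lab = {}"
  proof (rule ccontr)
    assume "\<not> ?thesis"
    then obtain v y where "y \<in> Y" and "closed_label i H lab y"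
      by (auto simp: closed_nodes_def)
    moreover from \<open>y \<in> Y\<close> obtain w where "proposal i H lab w = Some y"
      by (auto simp: Y_def)
    then obtain x u where "lab w = Some x" "bit x i" "(w, u) \<in> H" "lab u = Some y"
      by (rule proposal_SomeD)
    ultimately show False
      using fgraph_sym[OF H] unfolding closed_label_def by blast
  qed
  moreover have "finite (closed_nodes i H lab')"
    using dom_carve_step[of b i H "\<lambda>_. UNIV" lab]
    by (intro finite_subset[OF _ finite_dom_lab]) (auto simp: closed_nodes_def step)
  ultimately have "card (\<Union>y\<in>Y. ?A y) + card (closed_nodes i H lab) \<le> card (closed_nodes i H lab')"
    using card_Un_disjoint[of "\<Union>y\<in>Y. ?A y" "closed_nodes i H lab"]
      card_mono[of "closed_nodes i H lab'" "(\<Union>y\<in>Y. ?A y) \<union> closed_nodes i H lab"]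
      finite_subset[of _ "closed_nodes i H lab'"] by simp
  with 1 show ?thesis by linarith
qed

end

section \<open>A whole phase for one bit\<close>

lemma growth_bound:
  assumes "0 < b" shows "2 ^ L * (2 * b) ^ (2 * b * L) \<le> (2 * b + 1 :: nat) ^ (2 * b * L)"
proof -
  have "(2::nat) * a ^ a \<le> (a + 1) ^ a" if "0 < a" for a :: nat
  proof (cases a)
    case (Suc m)
    have "(a + 1) ^ a = (\<Sum>k\<le>a. (a choose k) * a ^ k)"
      using binomial_ring[of a 1 a] by simp
    \<comment> \<open>The two top terms of the binomial expansion each equal \<open>a ^ a\<close>,
      since \<open>m\<close> is \<open>a - 1\<close>. This is \<open>(1 + 1 / a) ^ a \<ge> 2\<close>
      in integers.\<close>
    also have "\<dots> \<ge> (\<Sum>k\<in>{m, a}. (a choose k) * a ^ k)"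
      by (rule sum_mono2) (auto simp: Suc)
    also have "(\<Sum>k\<in>{m, a}. (a choose k) * a ^ k) = 2 * a ^ a"
      by (simp add: Suc)
    finally show ?thesis .
  qed (use that in simp)
  from power_mono[OF this[of "2 * b"], of L] assms show ?thesis
    by (simp add: power_mult_distrib power_mult)
qed

text \<open>A zero-bit cluster still open after \<open>2 * b * L\<close> steps would have grown
  beyond \<open>2 ^ L\<close>. So all of them end closed, which settles bit \<open>i\<close>, and
  the deaths telescope against \<open>closed_nodes\<close>, of which there are at most
  \<open>card (Field H)\<close>.\<close>

lemma carve_phase:
  assumes H: "fgraph H" and b: "0 < b" and dom0: "dom lab \<subseteq> Field H"
    and n: "card (Field H) < 2 ^ L" and low: "low_bits_agree i H lab"
    and lab': "lab' = (carve_step b i H (\<lambda>_. UNIV) ^^ (2 * b * L)) lab"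
  shows "dom lab' \<subseteq> dom lab" "low_bits_agree (Suc i) H lab'"
    "2 * b * card (dom lab - dom lab') \<le> card (Field H)"
proof -
  define F where "F j = (carve_step b i H (\<lambda>_. UNIV) ^^ j) lab" for j
  have FS: "F (Suc j) = carve_step b i H (\<lambda>_. UNIV) (F j)" for j by (simp add: F_def)
  have domF: "dom (F j) \<subseteq> dom lab" for j
  proof (induction j)
    case (Suc j)
    then show ?case unfolding FS using dom_carve_step by (rule order_trans[rotated])
  qed (simp add: F_def)
  have domFH: "dom (F j) \<subseteq> Field H" for j using domF[of j] dom0 by simp
  have lowF: "low_bits_agree i H (F j)" for j
    by (induction j) (simp_all add: FS low low_bits_agree_carve_step, simp add: F_def low)
  have finF: "finite (dom (F j))" for j
    using domFH[of j] fgraph_finite_Field[OF H] by (rule finite_subset)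
  have finL: "finite (dom lab)"
    using dom0 fgraph_finite_Field[OF H] by (rule finite_subset)
  have deaths: "2 * b * card (dom lab - dom (F j)) \<le> card (closed_nodes i H (F j))" for j
  proof (induction j)
    case (Suc j)
    have "dom (F (Suc j)) \<subseteq> dom (F j)" unfolding FS by (rule dom_carve_step)
    then have "dom lab - dom (F (Suc j)) \<subseteq> (dom lab - dom (F j)) \<union> (dom (F j) - dom (F (Suc j)))"
      by blast
    then have "card (dom lab - dom (F (Suc j)))
        \<le> card (dom lab - dom (F j)) + card (dom (F j) - dom (F (Suc j)))"
      using finF finL by (meson card_Un_le card_mono finite_Diff finite_UnI order_trans)
    then have "2 * b * card (dom lab - dom (F (Suc j)))
        \<le> 2 * b * card (dom lab - dom (F j)) + 2 * b * card (dom (F j) - dom (F (Suc j)))"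
      by (metis add_mult_distrib2 mult_le_mono2)
    also have "\<dots> \<le> card (closed_nodes i H (F (Suc j)))"
      using Suc deaths_charged[OF H b domFH[of j] FS] by linarith
    finally show ?case .
  qed (simp add: F_def)
  \<comment> \<open>A label open after \<open>j\<close> steps was open before each of them, so its
    growth compounds from size at least one.\<close>
  have size: "(2 * b + 1) ^ j \<le> (2 * b) ^ j * card (cluster (F j) y)"
    if "\<not> bit y i" "F j v = Some y" "\<not> closed_label i H (F j) y" for j y v
    using that
  proof (induction j arbitrary: v)
    case 0
    then have "cluster (F 0) y \<noteq> {}" by auto
    moreover have "finite (cluster (F 0) y)"
      by (rule finite_subset[OF _ finF[of 0]]) auto
    ultimately have "card (cluster (F 0) y) > 0" by (meson card_gt_0_iff)
    then show ?case by simp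
  next
    case (Suc j)
    note g = open_label_growth[OF H b domFH[of j] FS Suc.prems]
    from g(1,2) Suc.IH Suc.prems(1) have "(2 * b + 1) ^ j \<le> (2 * b) ^ j * card (cluster (F j) y)"
      by blast
    then have "(2 * b + 1) ^ Suc j \<le> (2 * b) ^ j * ((2 * b + 1) * card (cluster (F j) y))"
      by (metis (no_types, lifting) mult.left_commute mult_le_mono2 power_Suc)
    also have "\<dots> \<le> (2 * b) ^ j * (2 * b * card (cluster (F (Suc j)) y))"
      using g(3) by simp
    finally show ?case by (simp add: ac_simps)
  qed
  let ?s = "2 * b * L"
  have lab'F: "lab' = F ?s" by (simp add: lab' F_def)
  have closed: "closed_label i H lab' y" if "\<not> bit y i" "lab' v = Some y" for y v
  proof (rule ccontr)
    assume "\<not> closed_label i H lab' y"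
    with size[of y ?s v] that have "(2 * b + 1) ^ ?s \<le> (2 * b) ^ ?s * card (cluster lab' y)"
      by (simp add: lab'F)
    also have "\<dots> < (2 * b) ^ ?s * 2 ^ L"
    proof -
      have "cluster lab' y \<subseteq> Field H" using domFH[of ?s] by (auto simp: lab'F)
      then have "card (cluster lab' y) < 2 ^ L"
        using card_mono[OF fgraph_finite_Field[OF H]] n by (meson le_less_trans)
      with b show ?thesis by simp
    qed
    also have "\<dots> \<le> (2 * b + 1) ^ ?s" using growth_bound[OF b, of L] by (simp add: mult.commute)
    finally show False by simp
  qed
  show "dom lab' \<subseteq> dom lab" using domF by (simp add: lab'F)
  show "low_bits_agree (Suc i) H lab'"
    unfolding low_bits_agree_def
  proof (intro allI impI)
    fix u v x y k
    assume uv: "(u, v) \<in> H" and xy: "lab' u = Some x" "lab' v = Some y" and "k < Suc i"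
    then consider "k < i" | "k = i" by linarith
    then show "bit x k = bit y k"
    proof cases
      case 1
      with lowF[of ?s] uv xy show ?thesis by (simp add: lab'F low_bits_agree_def)
    next
      \<comment> \<open>If either bit \<open>i\<close> is zero, that label is closed and forces the
        other bit to be zero; symmetry of \<open>H\<close> covers both directions.\<close>
      case 2
      with closed[of x u] closed[of y v] uv fgraph_sym[OF H uv] xy show ?thesis
        unfolding closed_label_def by blast
    qed
  qed
  have "closed_nodes i H lab' \<subseteq> Field H"
    using domFH[of ?s] by (auto simp: closed_nodes_def lab'F)
  then have "card (closed_nodes i H lab') \<le> card (Field H)"
    by (intro card_mono fgraph_finite_Field[OF H])
  with deaths[of ?s] show "2 * b * card (dom lab - dom lab') \<le> card (Field H)"
    by (simp add: lab'F)
qed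


section \<open>All phases in sequence\<close>

primrec labels ::
    "nat \<Rightarrow> nat \<Rightarrow> (nat \<Rightarrow> nat set) \<Rightarrow> nat rel \<Rightarrow> nat \<Rightarrow> (nat \<rightharpoonup> nat)" where
  "labels b L A H 0 = (\<lambda>v. if v \<in> Field H then Some v else None)"
| "labels b L A H (Suc t) = carve_step b (t div (2 * b * L)) H A (labels b L A H t)"

text \<open>One phase of \<open>2 * b * L\<close> steps for each of the \<open>b\<close> bits.
  \<open>labels\<close> flattens the phases into one recursion, so that radius and locality follow
  by induction on single steps.\<close>

definition carve_steps :: "nat \<Rightarrow> nat \<Rightarrow> nat" where
  "carve_steps b L = b * (2 * b * L)"

text \<open>A label travels one edge per step, starting from the node whose identifier it is. That
  node may itself have left the cluster, so only the weak diameter is bounded.\<close>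

lemma labels_radius:
  assumes H: "fgraph H" and "labels b L A H t v = Some y"
  shows "v \<in> Field H \<and> y \<in> Field H \<and> (v, y) \<in> H ^^ t"
  using assms(2)
proof (induction t arbitrary: v)
  case 0
  then show ?case by (auto split: if_splits)
next
  case (Suc t)
  let ?lab = "labels b L A H t"
  have "\<exists>u. (v, u) \<in> H \<and> ?lab u = Some y"
  proof (cases "?lab v = Some y")
    case True
    with Suc.IH fgraph_refl[OF H] show ?thesis by blast
  next
    case False
    with Suc.prems carve_step_SomeD[of b "t div (2 * b * L)" H A ?lab v y] show ?thesis
      by (auto elim: proposal_SomeD)
  qed
  then obtain u where "(v, u) \<in> H" "?lab u = Some y" by blast
  with Suc.IH show ?case by (meson FieldI1 relpow_Suc_I2)
qed

text \<open>Members and proposers of one cluster all lie within \<open>Suc t\<close> of the node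
  \<open>y\<close>, hence within \<open>2 * T\<close> of each other: counting in the ball equals
  counting globally.\<close>

lemma labels_visible_ball:
  assumes H: "fgraph H" and "t \<le> T"
  shows "labels b L (\<lambda>v. (H ^^ (2 * T)) `` {v}) H t = labels b L (\<lambda>_. UNIV) H t"
  using assms(2)
proof (induction t)
  case (Suc t)
  let ?lab = "labels b L (\<lambda>_. UNIV) H t" and ?B = "\<lambda>v. (H ^^ (2 * T)) `` {v}"
    and ?i = "t div (2 * b * L)"
  have "carve_step b ?i H ?B ?lab v = carve_step b ?i H (\<lambda>_. UNIV) ?lab v" for v
  proof (cases "proposal ?i H ?lab v")
    case None
    then show ?thesis by (simp add: carve_step_def)
  next
    case (Some y)
    have prp: "u \<in> Field H \<and> (u, y) \<in> H ^^ Suc t" if "proposal ?i H ?lab u = Some y" for u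
      using that labels_radius[OF H, of b L "\<lambda>_. UNIV" t]
      by (metis proposal_SomeD relpow_Suc_I2)
    have mono: "(u, y) \<in> H ^^ Suc t" if "?lab u = Some y" for u
      using labels_radius[OF H that] fgraph_relpow_mono[OF H, of u y t "Suc t"] by simp
    have near: "u \<in> ?B v" if "(u, y) \<in> H ^^ Suc t" for u
    proof -
      have "(y, u) \<in> H ^^ Suc t"
        using that relpow_sym H by (meson fgraph_def)
      with prp[OF Some] have "(v, u) \<in> H ^^ (Suc t + Suc t)" by (blast intro: relpow_trans)
      then show ?thesis
        using fgraph_relpow_mono[OF H, of v u "Suc t + Suc t" "2 * T"] prp[OF Some] Suc.prems
        by (simp del: relpow.simps)
    qed
    have "{u \<in> ?B v. ?lab u = Some y} = {u \<in> UNIV. ?lab u = Some y}"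
      using near mono by blast
    moreover have "{u \<in> ?B v. proposal ?i H ?lab u = Some y} = {u \<in> UNIV. proposal ?i H ?lab u = Some y}"
      using near prp by blast
    ultimately show ?thesis
      unfolding carve_step_def Some by (simp only: option.case)
  qed
  with Suc show ?case by (auto simp del: relpow.simps)
qed simp

lemma labels_phase:
  "k \<le> 2 * b * L \<Longrightarrow>
     labels b L A H (j * (2 * b * L) + k) = (carve_step b j H A ^^ k) (labels b L A H (j * (2 * b * L)))"
proof (induction k)
  case (Suc k)
  have "(j * s + k) div s = j" if "k < s" for s :: nat
    using that by simp
  with Suc.prems have "(j * (2 * b * L) + k) div (2 * b * L) = j"
    by (metis Suc_le_lessD)
  with Suc show ?case by (simp only: add_Suc_right labels.simps funpow.simps o_apply Suc_leD)
qed simp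

text \<open>Each of the \<open>b\<close> phases kills at most a fraction \<open>1 / (2 * b)\<close>
  of all nodes, so at least half survive, and adjacent survivors agree on all \<open>b\<close>
  bits.\<close>

lemma weak_carving:
  fixes b L :: nat
  defines "T \<equiv> carve_steps b L"
  defines "lab H \<equiv> labels b L (\<lambda>v. (H ^^ (2 * T)) `` {v}) H T"
  assumes H: "fgraph H" and b: "0 < b" and n: "card (Field H) < 2 ^ L"
    and ids: "Field H \<subseteq> {..<2 ^ b}"
  shows "lab H v = Some y \<Longrightarrow> v \<in> Field H \<and> (v, y) \<in> H ^^ T"
    and "(u, v) \<in> H \<Longrightarrow> lab H u = Some x \<Longrightarrow> lab H v = Some y \<Longrightarrow> x = y"
    and "card (Field H) \<le> 2 * card (dom (lab H))"
proof -
  define F where "F j = labels b L (\<lambda>_. UNIV) H (j * (2 * b * L))" for j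
  have FS: "F (Suc j) = (carve_step b j H (\<lambda>_. UNIV) ^^ (2 * b * L)) (F j)" for j
    using labels_phase[of "2 * b * L" b L "\<lambda>_. UNIV" H j] by (simp add: F_def add.commute)
  have lab: "lab H = F b"
    unfolding lab_def F_def using labels_visible_ball[OF H, of T T] by (simp add: T_def carve_steps_def)
  have F: "dom (F j) \<subseteq> Field H \<and> low_bits_agree j H (F j) \<and>
      2 * b * card (Field H - dom (F j)) \<le> j * card (Field H)" for j
  proof (induction j)
    case 0
    then show ?case by (auto simp: F_def low_bits_agree_def dom_def)
  next
    case (Suc j)
    then have IH: "dom (F j) \<subseteq> Field H" "low_bits_agree j H (F j)"
      "2 * b * card (Field H - dom (F j)) \<le> j * card (Field H)" by auto
    note ph = carve_phase[OF H b IH(1) n IH(2) FS]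
    have fin: "finite (Field H)" by (rule fgraph_finite_Field[OF H])
    have "Field H - dom (F (Suc j)) \<subseteq> (Field H - dom (F j)) \<union> (dom (F j) - dom (F (Suc j)))"
      by blast
    then have "card (Field H - dom (F (Suc j)))
        \<le> card (Field H - dom (F j)) + card (dom (F j) - dom (F (Suc j)))"
      using fin finite_subset[OF IH(1) fin]
      by (meson card_Un_le card_mono finite_Diff finite_UnI order_trans)
    then have "2 * b * card (Field H - dom (F (Suc j)))
        \<le> 2 * b * card (Field H - dom (F j)) + 2 * b * card (dom (F j) - dom (F (Suc j)))"
      by (metis add_mult_distrib2 mult_le_mono2)
    with ph IH show ?case by auto
  qed
  show "lab H v = Some y \<Longrightarrow> v \<in> Field H \<and> (v, y) \<in> H ^^ T"
    unfolding lab_def using labels_radius[OF H] by blast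
  show "x = y" if uv: "(u, v) \<in> H" and xy: "lab H u = Some x" "lab H v = Some y"
  proof -
    \<comment> \<open>Labels are identifiers, so agreement on the bits below \<open>b\<close> is
      equality.\<close>
    have "x < 2 ^ b" "y < 2 ^ b"
      using xy labels_radius[OF H] ids unfolding lab_def by blast+
    then have tb: "take_bit b x = x" "take_bit b y = y" by (simp_all add: take_bit_nat_eq_self)
    have "\<forall>k<b. bit x k = bit y k"
      using F[of b] uv xy unfolding lab low_bits_agree_def by blast
    then have "take_bit b x = take_bit b y"
      by (intro bit_eqI) (auto simp: bit_take_bit_iff)
    with tb show "x = y" by metis
  qed
  have "2 * card (Field H - dom (lab H)) \<le> card (Field H)"
    using F[of b] b by (simp add: lab)
  moreover have "card (Field H - dom (lab H)) = card (Field H) - card (dom (lab H))"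
    using F[of b] finite_subset[OF _ fgraph_finite_Field[OF H]] by (simp add: lab card_Diff_subset)
  ultimately show "card (Field H) \<le> 2 * card (dom (lab H))" by linarith
qed

section \<open>Coloring\<close>

text \<open>The choice is a fixed function of its arguments, so all nodes that see the same cluster
  and surroundings select the same set without communication.\<close>

definition local_carving :: "nat \<Rightarrow> 'a rel \<Rightarrow> 'a set \<Rightarrow> 'a set" where
  "local_carving L P C =
     (SOME M. M \<subseteq> (P ^^ L) `` C \<and> card C \<le> 2 * card M \<and> components_within (2 * L) P M)"

text \<open>Phrased from the viewpoint of \<open>v\<close>: it finds a labelled \<open>u\<close>
  nearby, reads the whole cluster off the ball around \<open>u\<close>, and carves within the
  neighborhood of that cluster only, which keeps the rule local.\<close>

definition carved :: "nat \<Rightarrow> nat \<Rightarrow> nat rel \<Rightarrow> nat set" where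
  "carved b L Q =
     (let H = Q ^^ (2 * L + 1); T = carve_steps b L; B = \<lambda>v. (H ^^ (2 * T)) `` {v};
          lab = labels b L B H T
      in {v. \<exists>u y. (v, u) \<in> H \<and> lab u = Some y \<and>
           (let C = {w \<in> B u. lab w = Some y} in v \<in> local_carving L (Restr Q (H `` C)) C)})"

primrec remaining :: "nat \<Rightarrow> nat \<Rightarrow> nat rel \<Rightarrow> nat \<Rightarrow> nat set" where
  "remaining b L R 0 = Field R"
| "remaining b L R (Suc j) = remaining b L R j - carved b L (Restr R (remaining b L R j))"

text \<open>The bound \<open>3 L\<close> makes the color depend on finitely many of the sets, even on junk inputs.\<close>

definition node_color :: "nat \<Rightarrow> nat \<Rightarrow> nat rel \<Rightarrow> nat \<Rightarrow> nat" where
  "node_color b L R v = (LEAST j. 3 * L \<le> j \<or> v \<notin> remaining b L R j)"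

lemma local_carving:
  assumes "fgraph P" "card (Field P) < 2 ^ L" "C \<subseteq> Field P"
  shows "local_carving L P C \<subseteq> (P ^^ L) `` C" "card C \<le> 2 * card (local_carving L P C)"
    "components_within (2 * L) P (local_carving L P C)"
  using someI_ex[OF ball_carving[OF assms]] unfolding local_carving_def by auto

text \<open>Carved nodes stay within \<open>L\<close> of their cluster and clusters are more than
  \<open>2 * L + 1\<close> apart, so the separate carvings do not interact. The factor 4 is 2 for
  nodes killed times 2 for nodes lost in ball growing.\<close>

lemma carved:
  assumes Q: "fgraph Q" and b: "0 < b" and n: "card (Field Q) < 2 ^ L"
    and ids: "Field Q \<subseteq> {..<2 ^ b}"
  shows "carved b L Q \<subseteq> Field Q" "card (Field Q) \<le> 4 * card (carved b L Q)"
    "components_within (2 * L) Q (carved b L Q)"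
proof -
  define H where "H = Q ^^ (2 * L + 1)"
  define T where "T = carve_steps b L"
  define B where "B = (\<lambda>v. (H ^^ (2 * T)) `` {v})"
  define lab where "lab = labels b L B H T"
  define C where "C y = cluster lab y" for y
  define P where "P y = Restr Q (H `` C y)" for y
  define M where "M y = local_carving L (P y) (C y)" for y
  have finQ: "finite (Field Q)" by (rule fgraph_finite_Field[OF Q])
  have H: "fgraph H" "Field H = Field Q"
    using fgraph_relpow[OF Q, of "2 * L + 1"] by (simp_all add: H_def del: relpow.simps)
  note weak = weak_carving[OF H(1) b, of L, folded T_def, folded B_def, folded lab_def,
      unfolded H(2), OF n ids]
  have QH: "(u, v) \<in> H" if "u \<in> Field Q" "(u, v) \<in> Q ^^ k" "k \<le> 2 * L + 1" for u v k
    using fgraph_relpow_mono[OF Q that] by (simp add: H_def del: relpow.simps)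
  have CQ: "C y \<subseteq> Field Q" for y using weak(1) by (auto simp: C_def)
  have P: "fgraph (P y)" "Field (P y) = Field Q \<inter> H `` C y" for y
    using fgraph_Restr[OF Q] by (simp_all add: P_def)
  have CP: "C y \<subseteq> Field (P y)" for y
    using CQ[of y] fgraph_refl[OF H(1)] H(2) P(2) by auto
  have "card (Field (P y)) < 2 ^ L" for y
    using card_mono[OF finQ, of "Field (P y)"] P(2) n by auto
  note M = local_carving[OF P(1) this CP, folded M_def]
  have MP: "M y \<subseteq> Field (P y)" for y
    using M(1)[of y] CP[of y] relpow_Field[of _ _ L "P y"] by blast
  have near: "\<exists>c. lab c = Some y \<and> (c, v) \<in> Q ^^ L" if v: "v \<in> M y" for v y
  proof -
    obtain c where "c \<in> C y" "(c, v) \<in> P y ^^ L" using M(1) v by blast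
    moreover have "P y ^^ L \<subseteq> Q ^^ L" by (rule relpow_mono_base) (auto simp: P_def)
    ultimately show ?thesis by (auto simp: C_def)
  qed
  \<comment> \<open>Any two members of a cluster are within \<open>T\<close> of the node
    \<open>y\<close>, so the ball of radius \<open>2 * T\<close> around one shows all of
    them.\<close>
  have view: "{w \<in> B u. lab w = Some y} = C y" if "lab u = Some y" for u y
  proof -
    have "w \<in> B u" if "lab w = Some y" for w
    proof -
      have "(y, w) \<in> H ^^ T" using weak(1)[OF that] relpow_sym H(1) by (meson fgraph_def)
      with weak(1)[OF \<open>lab u = Some y\<close>] have "(u, w) \<in> H ^^ (T + T)" by (blast intro: relpow_trans)
      then show ?thesis by (simp add: B_def mult_2)
    qed
    then show ?thesis by (auto simp: C_def)
  qed
  have carved_eq: "carved b L Q = (\<Union>y\<in>ran lab. M y)"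
  proof -
    have "carved b L Q = {v. \<exists>u y. (v, u) \<in> H \<and> lab u = Some y \<and>
        v \<in> local_carving L (Restr Q (H `` {w \<in> B u. lab w = Some y})) {w \<in> B u. lab w = Some y}}"
      unfolding carved_def Let_def lab_def B_def H_def T_def ..
    also have "\<dots> = {v. \<exists>u y. (v, u) \<in> H \<and> lab u = Some y \<and> v \<in> M y}"
      using view by (auto simp: M_def P_def)
    also have "\<dots> = (\<Union>y\<in>ran lab. M y)"
    proof (intro equalityI subsetI)
      fix v assume "v \<in> (\<Union>y\<in>ran lab. M y)"
      then obtain y where v: "v \<in> M y" by auto
      with near obtain c where c: "lab c = Some y" "(c, v) \<in> Q ^^ L" by blast
      with QH[of c v L] weak(1) have "(c, v) \<in> H" by simp
      with c v fgraph_sym[OF H(1)] show "v \<in> {v. \<exists>u y. (v, u) \<in> H \<and> lab u = Some y \<and> v \<in> M y}"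
        by blast
    qed (auto simp: ran_def)
    finally show ?thesis .
  qed
  have sep: "y = z" if uv: "u \<in> M y" "v \<in> M z" "(u, v) \<in> Q" for u v y z
  proof -
    obtain c d where c: "lab c = Some y" "(c, u) \<in> Q ^^ L" and d: "lab d = Some z" "(d, v) \<in> Q ^^ L"
      using near uv by blast
    from d(2) have vd: "(v, d) \<in> Q ^^ L" using relpow_sym Q by (meson fgraph_def)
    \<comment> \<open>From \<open>c\<close> to \<open>u\<close>, across the edge, from
      \<open>v\<close> to \<open>d\<close>: exactly the exponent \<open>2 * L + 1\<close> of
      \<open>H\<close>.\<close>
    have "(c, d) \<in> Q ^^ (Suc L + L)"
      using relpow_trans[OF relpow_Suc_I[OF c(2) uv(3)] vd] .
    then have "(c, d) \<in> H" using QH[of c d "Suc L + L"] weak(1)[OF c(1)]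
      by (simp del: relpow.simps)
    with weak(2) c d show ?thesis by blast
  qed
  show "carved b L Q \<subseteq> Field Q"
    using MP P(2) by (auto simp: carved_eq)
  show "components_within (2 * L) Q (carved b L Q)"
    unfolding carved_eq
  proof (rule components_within_UN)
    fix y
    have "Restr (P y) (M y) = Restr Q (M y)"
      using MP[of y] P(2)[of y] by (auto simp: P_def)
    with M(3)[of y] show "components_within (2 * L) Q (M y)"
      by (simp add: components_within_def)
  qed (rule sep)
  have "dom lab \<subseteq> Field Q" using weak(1) by auto
  then have "finite (ran lab)" using finite_subset[OF _ finQ] by (auto intro: finite_ran)
  moreover have "finite (M y)" "finite (C y)" for y
    using finite_subset[OF _ finQ] MP[of y] P(2)[of y] CQ[of y] by auto
  ultimately have fin: "finite (ran lab)" "finite (M y)" "finite (C y)" for y by auto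
  have disj: "M y \<inter> M z = {}" if "y \<noteq> z" for y z
    using sep[of _ y _ z] that fgraph_refl[OF Q] MP[of y] P(2)[of y] by blast
  have "card (dom lab) \<le> card (\<Union>y\<in>ran lab. C y)"
    using fin by (intro card_mono) (auto simp: C_def ran_def)
  also have "\<dots> \<le> (\<Sum>y\<in>ran lab. card (C y))" using fin by (intro card_UN_le)
  also have "\<dots> \<le> (\<Sum>y\<in>ran lab. 2 * card (M y))" by (intro sum_mono M(2))
  also have "\<dots> = 2 * card (carved b L Q)"
    unfolding carved_eq using fin disj
    by (subst card_UN_disjoint) (auto simp: sum_distrib_left)
  finally show "card (Field Q) \<le> 4 * card (carved b L Q)"
    using weak(3) by linarith
qed

lemma remaining_subset: "remaining b L R j \<subseteq> Field R"
  by (induction j) auto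

lemma remaining_antimono: "i \<le> j \<Longrightarrow> remaining b L R j \<subseteq> remaining b L R i"
  by (rule lift_Suc_antimono_le) auto

text \<open>Every color removes at least a quarter of what remains, so fewer than
  \<open>(27 / 64) ^ L * 2 ^ L \<le> 1\<close> nodes are left after \<open>3 * L\<close>
  colors.\<close>

lemma
  assumes R: "fgraph R" and b: "0 < b" and n: "card (Field R) < 2 ^ L"
    and ids: "Field R \<subseteq> {..<2 ^ b}"
  shows node_color_range: "v \<in> Field R \<Longrightarrow> node_color b L R v \<in> {1..3 * L}"
    and node_color_components:
      "1 \<le> i \<Longrightarrow> i \<le> 3 * L \<Longrightarrow>
       components_within (2 * L) R {v \<in> Field R. node_color b L R v = i}"
proof -
  define S where "S j = remaining b L R j" for j
  define Q where "Q j = Restr R (S j)" for j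
  have S0: "S 0 = Field R" and SS: "S (Suc j) = S j - carved b L (Q j)" for j
    by (simp_all add: S_def Q_def)
  have SR: "S j \<subseteq> Field R" for j using remaining_subset by (simp add: S_def)
  have finR: "finite (Field R)" by (rule fgraph_finite_Field[OF R])
  have Q: "fgraph (Q j)" "Field (Q j) = S j" for j
    using fgraph_Restr[OF R, of "S j"] SR[of j] by (auto simp: Q_def)
  have "card (Field (Q j)) < 2 ^ L" "Field (Q j) \<subseteq> {..<2 ^ b}" for j
    using card_mono[OF finR SR, of j] n SR ids Q(2) by auto
  note carved = carved[OF Q(1) b this, unfolded Q(2)]
  have "4 ^ j * card (S j) \<le> 3 ^ j * card (Field R)" for j
  proof (induction j)
    case (Suc j)
    have "card (S (Suc j)) = card (S j) - card (carved b L (Q j))"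
      unfolding SS using carved(1) finite_subset[OF SR finR]
      by (meson card_Diff_subset finite_subset)
    with carved(2)[of j] have "4 * card (S (Suc j)) \<le> 3 * card (S j)" by linarith
    then have "4 ^ j * (4 * card (S (Suc j))) \<le> 3 * (4 ^ j * card (S j))" by simp
    also have "\<dots> \<le> 3 * (3 ^ j * card (Field R))" using Suc by simp
    finally show ?case by (simp add: ac_simps)
  qed (simp add: S0)
  from this[of "3 * L"] have "64 ^ L * card (S (3 * L)) \<le> 27 ^ L * card (Field R)"
    by (simp add: power_mult)
  also have "\<dots> < 27 ^ L * 2 ^ L" using n by simp
  also have "\<dots> = (54::nat) ^ L" by (simp flip: power_mult_distrib)
  also have "\<dots> \<le> 64 ^ L" by (rule power_mono) auto
  finally have "card (S (3 * L)) = 0" by simp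
  then have S3: "S (3 * L) = {}" using finite_subset[OF SR finR] by simp
  have color: "node_color b L R v = (LEAST j. v \<notin> S j)" for v
  proof -
    have "(3 * L \<le> j \<or> v \<notin> S j) \<longleftrightarrow> v \<notin> S j" for j
      using S3 remaining_antimono[of "3 * L" j b L R] by (auto simp: S_def)
    then show ?thesis by (simp add: node_color_def S_def)
  qed
  have le: "node_color b L R v \<le> 3 * L" for v
    unfolding color by (rule Least_le) (simp add: S3)
  have notin: "v \<notin> S (node_color b L R v)" for v
    unfolding color by (rule LeastI[of _ "3 * L"]) (simp add: S3)
  show "node_color b L R v \<in> {1..3 * L}" if "v \<in> Field R"
    using le[of v] notin[of v] that S0 by (cases "node_color b L R v") auto
  show "components_within (2 * L) R {v \<in> Field R. node_color b L R v = i}"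
    if i: "1 \<le> i" "i \<le> 3 * L"
  proof -
    obtain j where j: "i = Suc j" using i by (cases i) auto
    \<comment> \<open>The least index of absence is one more than the stage that carves
      \<open>v\<close>; color 0 does not occur because \<open>S 0\<close> is the whole
      field.\<close>
    have "node_color b L R v = Suc j \<longleftrightarrow> v \<in> S j \<and> v \<notin> S (Suc j)" for v
    proof
      assume "node_color b L R v = Suc j"
      then show "v \<in> S j \<and> v \<notin> S (Suc j)"
        using notin[of v] not_less_Least[of j "\<lambda>j. v \<notin> S j"] by (auto simp: color)
    next
      assume v: "v \<in> S j \<and> v \<notin> S (Suc j)"
      show "node_color b L R v = Suc j"
        unfolding color
      proof (rule Least_equality)
        fix k assume "v \<notin> S k"
        then show "Suc j \<le> k"
          using v remaining_antimono[of k j b L R] by (force simp: S_def not_le[symmetric])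
      qed (use v in simp)
    qed
    then have eq: "{v \<in> Field R. node_color b L R v = i} = carved b L (Q j)"
      using SR[of j] carved(1)[of j] by (auto simp: j SS)
    have "Restr (Q j) (carved b L (Q j)) = Restr R (carved b L (Q j))"
      using carved(1)[of j] by (auto simp: Q_def)
    with carved(3)[of j] show ?thesis
      by (simp add: eq components_within_def)
  qed
qed

section \<open>Locality\<close>

text \<open>
  The computation on \<open>R\<close> is compared with the one on \<open>Restr R W\<close>: a quantity with dependency
  radius \<open>\<rho>\<close> is the same for both at every node whose \<open>\<rho>\<close>-ball lies in \<open>W\<close>.
\<close>

definition deep :: "'a rel \<Rightarrow> 'a set \<Rightarrow> nat \<Rightarrow> 'a \<Rightarrow> bool" where
  "deep R W \<rho> v \<longleftrightarrow> v \<in> Field R \<and> (R ^^ \<rho>) `` {v} \<subseteq> W"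

definition agree :: "'a rel \<Rightarrow> 'a set \<Rightarrow> nat \<Rightarrow> ('a \<Rightarrow> 'b) \<Rightarrow> ('a \<Rightarrow> 'b) \<Rightarrow> bool" where
  "agree R W \<rho> f g \<longleftrightarrow> (\<forall>v. deep R W \<rho> v \<longrightarrow> f v = g v)"

lemma agreeI: "(\<And>v. deep R W \<rho> v \<Longrightarrow> f v = g v) \<Longrightarrow> agree R W \<rho> f g"
  by (simp add: agree_def)

lemma agreeD: "agree R W \<rho> f g \<Longrightarrow> deep R W \<rho> v \<Longrightarrow> f v = g v"
  by (simp add: agree_def)

lemma proposal_cong:
  assumes "H `` {v} = H' `` {v}" "lab v = lab' v" "\<And>u. u \<in> H `` {v} \<Longrightarrow> lab u = lab' u"
  shows "proposal i H lab v = proposal i H' lab' v"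
proof -
  have "(v, u) \<in> H \<longleftrightarrow> (v, u) \<in> H'" for u using assms(1) by blast
  then have *: "(v, u) \<in> H \<and> lab u = Some y \<longleftrightarrow> (v, u) \<in> H' \<and> lab' u = Some y" for u y
    using assms(3) by auto
  have "(\<exists>u y. (v, u) \<in> H \<and> lab u = Some y \<and> \<not> bit y i) \<longleftrightarrow>
      (\<exists>u y. (v, u) \<in> H' \<and> lab' u = Some y \<and> \<not> bit y i)"
    using * by blast
  then show ?thesis unfolding proposal_def assms(2) * by (simp only:)
qed

lemma carve_step_cong:
  assumes "A v = A' v" "proposal i H lab v = proposal i H' lab' v" "lab v = lab' v"
    "\<And>u. u \<in> A v \<Longrightarrow> lab u = lab' u"
    "\<And>u. u \<in> A v \<Longrightarrow> proposal i H lab u = proposal i H' lab' u"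
  shows "carve_step b i H A lab v = carve_step b i H' A' lab' v"
proof -
  have sets: "{u \<in> A v. lab u = Some y} = {u \<in> A' v. lab' u = Some y}"
    "{u \<in> A v. proposal i H lab u = Some y} = {u \<in> A' v. proposal i H' lab' u = Some y}" for y
    using assms by auto
  show ?thesis unfolding carve_step_def assms(2,3) sets ..
qed

text \<open>
  With \<open>K = 2 L + 1\<close>: the leading \<open>1\<close> accounts for the set of uncolored nodes, \<open>K\<close> for the power
  graph, \<open>K + 2 T K\<close> for each of the \<open>T\<close> steps, and \<open>2 K + 2 T K\<close> for reading off the result.
\<close>

definition color_radius :: "nat \<Rightarrow> nat \<Rightarrow> nat" where
  "color_radius b L =
     (let T = carve_steps b L in Suc ((2 * L + 1) * (T * (2 * T + 1) + (2 * T + 3))))"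

section \<open>Bookkeeping of dependency radii\<close>

context
  fixes R :: "'a rel" and W :: "'a set"
  assumes R: "fgraph R"
begin

lemma deep_mono:
  assumes "deep R W \<rho> v" "\<rho>' \<le> \<rho>" shows "deep R W \<rho>' v"
  using assms fgraph_relpow_mono[OF R _ _ assms(2)] unfolding deep_def by blast

lemma deep_neighbor:
  assumes "deep R W (\<rho> + k) v" "(v, u) \<in> R ^^ k" shows "deep R W \<rho> u"
  using assms relpow_Field[OF assms(2)] relpow_trans[OF assms(2)]
  unfolding deep_def by (force simp: add.commute)

lemma deep_self: "deep R W \<rho> v \<Longrightarrow> v \<in> Field R \<and> v \<in> W"
  using fgraph_relpow_refl[OF R] by (auto simp: deep_def)

lemma agree_mono: "agree R W \<rho> f g \<Longrightarrow> \<rho> \<le> \<rho>' \<Longrightarrow> agree R W \<rho>' f g"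
  using deep_mono unfolding agree_def by blast

text \<open>Each step of \<open>Q\<close> costs \<open>k\<close> of the depth. Splitting off the
  first step leaves its target deep enough for the induction hypothesis.\<close>

lemma agree_relpow:
  assumes Q: "Q \<subseteq> R ^^ k" and ag: "agree R W \<rho> (\<lambda>v. Q `` {v}) (\<lambda>v. Q' `` {v})"
  shows "agree R W (\<rho> + n * k) (\<lambda>v. (Q ^^ n) `` {v}) (\<lambda>v. (Q' ^^ n) `` {v})"
proof (induction n)
  case (Suc n)
  show ?case
  proof (rule agreeI)
    fix v assume "deep R W (\<rho> + Suc n * k) v"
    then have v: "deep R W (\<rho> + n * k + k) v" by (simp add: ac_simps)
    have step: "(P ^^ Suc n) `` {v} = (\<Union>u\<in>P `` {v}. (P ^^ n) `` {u})" for P :: "'a rel"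
      by (auto dest: relpow_Suc_D2 intro: relpow_Suc_I2 simp del: relpow.simps)
    have "deep R W \<rho> v" by (rule deep_mono[OF v]) simp
    then have "Q `` {v} = Q' `` {v}" by (rule agreeD[OF ag])
    moreover have "(Q ^^ n) `` {u} = (Q' ^^ n) `` {u}" if "u \<in> Q `` {v}" for u
    proof (rule agreeD[OF Suc])
      show "deep R W (\<rho> + n * k) u"
        using deep_neighbor[OF v] that Q by blast
    qed
    ultimately show "(Q ^^ Suc n) `` {v} = (Q' ^^ Suc n) `` {v}"
      unfolding step by (metis (no_types, lifting) SUP_cong)
  qed
qed (simp add: agree_def)

lemma agree_Restr:
  assumes "agree R W \<rho> (\<lambda>v. v \<in> S) (\<lambda>v. v \<in> S')"
  shows "agree R W (\<rho> + 1) (\<lambda>v. Restr R S `` {v}) (\<lambda>v. Restr (Restr R W) S' `` {v})"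
proof (rule agreeI)
  fix v assume v: "deep R W (\<rho> + 1) v"
  have "deep R W \<rho> v" by (rule deep_mono[OF v]) simp
  with assms have "v \<in> W" "v \<in> S \<longleftrightarrow> v \<in> S'"
    using deep_self by (auto simp: agree_def)
  moreover have "u \<in> W \<and> (u \<in> S \<longleftrightarrow> u \<in> S')" if "(v, u) \<in> R" for u
    using deep_neighbor[OF v, of u] that deep_self assms by (auto simp: agree_def)
  ultimately show "Restr R S `` {v} = Restr (Restr R W) S' `` {v}" by auto
qed

end

context
  fixes R :: "nat rel" and W :: "nat set"
  assumes R: "fgraph R"
begin

text \<open>\<open>m\<close> pays for reaching the nodes counted in \<open>A v\<close>, and
  \<open>k\<close> for the labels of their neighbors, on which their proposals depend.\<close>

lemma agree_carve_step:
  assumes H: "H \<subseteq> R ^^ k" "agree R W \<rho> (\<lambda>v. H `` {v}) (\<lambda>v. H' `` {v})"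
    and A: "\<And>v. A v \<subseteq> (R ^^ m) `` {v}" "agree R W (\<rho> + m) A A'"
    and lab: "agree R W \<sigma> lab lab'" and \<rho>\<sigma>: "\<rho> \<le> \<sigma>"
  shows "agree R W (\<sigma> + (k + m)) (carve_step b i H A lab) (carve_step b i H' A' lab')"
proof (rule agreeI)
  have p: "proposal i H lab v = proposal i H' lab' v" if v: "deep R W (\<sigma> + k) v" for v
  proof (rule proposal_cong)
    show "H `` {v} = H' `` {v}"
      by (rule agreeD[OF H(2)], rule deep_mono[OF R v]) (use \<rho>\<sigma> in simp)
    show "lab v = lab' v"
      by (rule agreeD[OF lab], rule deep_mono[OF R v]) simp
    show "lab u = lab' u" if "u \<in> H `` {v}" for u
      by (rule agreeD[OF lab], rule deep_neighbor[OF R v]) (use that H(1) in blast)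
  qed
  fix v assume "deep R W (\<sigma> + (k + m)) v"
  then have v: "deep R W (\<sigma> + k + m) v" by (simp add: ac_simps)
  have u: "deep R W (\<sigma> + k) u" if "u \<in> A v" for u
    by (rule deep_neighbor[OF R v]) (use that A(1) in blast)
  show "carve_step b i H A lab v = carve_step b i H' A' lab' v"
  proof (rule carve_step_cong)
    show "A v = A' v"
      by (rule agreeD[OF A(2)], rule deep_mono[OF R v]) (use \<rho>\<sigma> in simp)
    show "proposal i H lab v = proposal i H' lab' v"
      by (rule p, rule deep_mono[OF R v]) simp
    show "lab v = lab' v"
      by (rule agreeD[OF lab], rule deep_mono[OF R v]) simp
    show "lab u = lab' u" if "u \<in> A v" for u
      by (rule agreeD[OF lab], rule deep_mono[OF R u[OF that]]) simp
    show "proposal i H lab u = proposal i H' lab' u" if "u \<in> A v" for u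
      by (rule p, rule u, rule that)
  qed
qed

lemma agree_labels:
  assumes H: "H \<subseteq> R ^^ k" "agree R W \<rho> (\<lambda>v. H `` {v}) (\<lambda>v. H' `` {v})"
    and F: "agree R W \<rho> (\<lambda>v. v \<in> Field H) (\<lambda>v. v \<in> Field H')"
    and A: "\<And>v. A v \<subseteq> (R ^^ m) `` {v}" "agree R W (\<rho> + m) A A'"
  shows "agree R W (\<rho> + t * (k + m)) (labels b L A H t) (labels b L A' H' t)"
proof (induction t)
  case 0
  with F show ?case by (auto simp: agree_def)
next
  case (Suc t)
  from agree_carve_step[OF H A Suc, of b "t div (2 * b * L)"] show ?case
    by (simp add: ac_simps)
qed

lemma agree_carved:
  assumes Q: "fgraph Q" "Q \<subseteq> R" "agree R W \<rho> (\<lambda>v. Q `` {v}) (\<lambda>v. Q' `` {v})"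
    and Q': "fgraph Q'"
  shows "agree R W (\<rho> + (color_radius b L - 1)) (\<lambda>v. v \<in> carved b L Q) (\<lambda>v. v \<in> carved b L Q')"
proof (rule agreeI)
  define K where "K = 2 * L + 1"
  define T where "T = carve_steps b L"
  define B where "B H = (\<lambda>v. (H ^^ (2 * T)) `` {v})" for H :: "nat rel"
  define lab where "lab H = labels b L (B H) H T" for H
  define C where "C H u y = {w \<in> B H u. lab H w = Some y}" for H u y
  let ?H = "Q ^^ K" and ?H' = "Q' ^^ K"
  have carved: "carved b L P = {v. \<exists>u y. (v, u) \<in> P ^^ K \<and> lab (P ^^ K) u = Some y \<and>
      v \<in> local_carving L (Restr P ((P ^^ K) `` C (P ^^ K) u y)) (C (P ^^ K) u y)}" for P
    unfolding carved_def Let_def lab_def C_def B_def T_def K_def ..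
  have HK: "?H \<subseteq> R ^^ K" using Q(2) by (rule relpow_mono_base)
  have BK: "B ?H v \<subseteq> (R ^^ (2 * T * K)) `` {v}" for v
    unfolding B_def using relpow_mono_base[OF HK, of "2 * T"] by (auto simp: relpow_relpow)
  define \<rho>1 where "\<rho>1 = \<rho> + K"
  have H: "agree R W \<rho>1 (\<lambda>v. ?H `` {v}) (\<lambda>v. ?H' `` {v})"
    using agree_relpow[OF R _ Q(3), of 1 K] Q(2) by (simp add: \<rho>1_def)
  have B: "agree R W (\<rho>1 + 2 * T * K) (B ?H) (B ?H')"
    unfolding B_def by (rule agree_relpow[OF R HK H])
  \<comment> \<open>Loops make membership in the field visible as a nonempty neighborhood, hence as
    local information.\<close>
  have F: "v \<in> Field (P ^^ K) \<longleftrightarrow> P `` {v} \<noteq> {}" if "fgraph P" for P :: "nat rel" and v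
    using fgraph_relpow(2)[OF that, of K] fgraph_refl[OF that] by (auto simp: K_def Field_def)
  have F: "agree R W \<rho>1 (\<lambda>v. v \<in> Field ?H) (\<lambda>v. v \<in> Field ?H')"
    by (rule agree_mono[OF R, of _ \<rho>])
      (use Q(3) F[OF Q(1)] F[OF Q'] in \<open>auto simp: agree_def \<rho>1_def\<close>)
  define \<sigma> where "\<sigma> = \<rho>1 + T * (K + 2 * T * K)"
  have \<sigma>: "\<rho> \<le> \<sigma>" "\<rho>1 \<le> \<sigma>" by (simp_all add: \<sigma>_def \<rho>1_def)
  have lab: "agree R W \<sigma> (lab ?H) (lab ?H')"
    unfolding lab_def \<sigma>_def by (rule agree_labels[OF HK H F BK B])
  fix v assume "deep R W (\<rho> + (color_radius b L - 1)) v"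
  moreover have "\<rho> + (color_radius b L - 1) = \<sigma> + K + 2 * T * K + K"
    by (simp add: color_radius_def Let_def \<sigma>_def \<rho>1_def K_def T_def algebra_simps)
  ultimately have v: "deep R W (\<sigma> + K + 2 * T * K + K) v" by simp
  \<comment> \<open>The depth is spent from \<open>v\<close> to a labelled \<open>u\<close>, on to a
    \<open>w\<close> in the ball of \<open>u\<close>, and on to an \<open>x\<close> near the
    cluster, where the edges of \<open>Q\<close> must still agree.\<close>
  have u: "deep R W (\<sigma> + K + 2 * T * K) u" if "(v, u) \<in> ?H" for u
    by (rule deep_neighbor[OF R v]) (use that HK in blast)
  have w: "deep R W (\<sigma> + K) w" if "(v, u) \<in> ?H" "w \<in> B ?H u" for u w
    by (rule deep_neighbor[OF R u[OF that(1)]]) (use that BK in blast)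
  have x: "deep R W \<sigma> x" if "(v, u) \<in> ?H" "w \<in> B ?H u" "(w, x) \<in> ?H" for u w x
    by (rule deep_neighbor[OF R w[OF that(1,2)]]) (use that HK in blast)
  have Hv: "(v, u) \<in> ?H \<longleftrightarrow> (v, u) \<in> ?H'" for u
    using agreeD[OF H deep_mono[OF R v, of \<rho>1]] \<sigma> by auto
  have labu: "lab ?H u = lab ?H' u" if "(v, u) \<in> ?H" for u
    by (rule agreeD[OF lab], rule deep_mono[OF R u[OF that]]) simp
  have Bu: "B ?H u = B ?H' u" if "(v, u) \<in> ?H" for u
    by (rule agreeD[OF B], rule deep_mono[OF R u[OF that]]) (use \<sigma> in simp)
  have labw: "lab ?H w = lab ?H' w" if "(v, u) \<in> ?H" "w \<in> B ?H u" for u w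
    by (rule agreeD[OF lab], rule deep_mono[OF R w[OF that]]) simp
  have C: "C ?H u y = C ?H' u y" if "(v, u) \<in> ?H" for u y
    unfolding C_def using Bu[OF that] labw[OF that] by auto
  have Hw: "?H `` {w} = ?H' `` {w}" if "(v, u) \<in> ?H" "w \<in> B ?H u" for u w
    by (rule agreeD[OF H], rule deep_mono[OF R w[OF that]]) (use \<sigma> in simp)
  have HC: "?H `` (C ?H u y) = ?H' `` C ?H' u y" if "(v, u) \<in> ?H" for u y
    using Hw[OF that] unfolding C[OF that, symmetric] by (auto simp: C_def)
  have Qx: "Q `` {x} = Q' `` {x}" if "(v, u) \<in> ?H" "x \<in> ?H `` (C ?H u y)" for u x y
  proof -
    from that(2) obtain z where "z \<in> B ?H u" "(z, x) \<in> ?H" by (auto simp: C_def)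
    from x[OF that(1) this] show ?thesis
      using agreeD[OF Q(3)] deep_mono[OF R _ \<sigma>(1)] by blast
  qed
  have P: "Restr Q (?H `` (C ?H u y)) = Restr Q' (?H' `` C ?H' u y)" if "(v, u) \<in> ?H" for u y
    unfolding HC[OF that, symmetric] using Qx[OF that] by blast
  have LC: "local_carving L (Restr Q (?H `` (C ?H u y))) (C ?H u y) =
      local_carving L (Restr Q' (?H' `` (C ?H' u y))) (C ?H' u y)" if "(v, u) \<in> ?H" for u y
    unfolding P[OF that] unfolding C[OF that] ..
  show "(v \<in> carved b L Q) = (v \<in> carved b L Q')"
    unfolding carved mem_Collect_eq
    by (intro ex_cong1 conj_cong Hv) (simp_all only: labu LC Hv[symmetric])
qed

lemma agree_remaining:
  "agree R W (j * color_radius b L)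
     (\<lambda>v. v \<in> remaining b L R j) (\<lambda>v. v \<in> remaining b L (Restr R W) j)"
proof (induction j)
  case 0
  then show ?case
    using deep_self[OF R] fgraph_Restr[OF R] by (auto simp: agree_def)
next
  case (Suc j)
  let ?S = "remaining b L R j" and ?S' = "remaining b L (Restr R W) j"
    and ?\<rho> = "j * color_radius b L"
  \<comment> \<open>The \<open>1\<close> pays for \<open>agree_Restr\<close>, the rest for
    \<open>agree_carved\<close>.\<close>
  have eq: "?\<rho> + 1 + (color_radius b L - 1) = Suc j * color_radius b L"
    by (simp add: color_radius_def Let_def)
  have "agree R W (?\<rho> + 1 + (color_radius b L - 1))
      (\<lambda>v. v \<in> carved b L (Restr R ?S)) (\<lambda>v. v \<in> carved b L (Restr (Restr R W) ?S'))"
    by (rule agree_carved[OF _ _ agree_Restr[OF R Suc]]) (auto intro: fgraph_Restr R)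
  then have "agree R W (Suc j * color_radius b L)
      (\<lambda>v. v \<in> carved b L (Restr R ?S)) (\<lambda>v. v \<in> carved b L (Restr (Restr R W) ?S'))"
    unfolding eq .
  moreover have "agree R W (Suc j * color_radius b L) (\<lambda>v. v \<in> ?S) (\<lambda>v. v \<in> ?S')"
    by (rule agree_mono[OF R Suc]) simp
  ultimately show ?case by (simp add: agree_def)
qed

lemma node_color_local:
  assumes "deep R W (3 * L * color_radius b L) v"
  shows "node_color b L R v = node_color b L (Restr R W) v"
proof -
  have "v \<in> remaining b L R j \<longleftrightarrow> v \<in> remaining b L (Restr R W) j" if "j \<le> 3 * L" for j
    by (rule agreeD[OF agree_remaining], rule deep_mono[OF R assms]) (use that in simp)
  then have "(3 * L \<le> j \<or> v \<notin> remaining b L R j) \<longleftrightarrow>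
      (3 * L \<le> j \<or> v \<notin> remaining b L (Restr R W) j)" for j
    using nat_le_linear by blast
  then show ?thesis by (simp add: node_color_def)
qed

end

section \<open>Gathering balls in the LOCAL model\<close>

text \<open>Nodes only know identifiers, so the network is transported to them. The added loops also
  keep isolated nodes in the field.\<close>

definition id_graph :: "'a pair_pre_digraph \<Rightarrow> ('a \<Rightarrow> nat) \<Rightarrow> nat rel" where
  "id_graph G ident =
     {(ident u, ident v) | u v. u \<in> pverts G \<and> v \<in> pverts G \<and> (u = v \<or> (u, v) \<in> parcs G)}"

text \<open>States and messages are to be natural numbers, so the bound, the round counter, the own
  identifier and the known arcs are packed into one.\<close>

definition encode_state :: "nat \<times> nat \<times> nat \<times> nat rel \<Rightarrow> nat" where
  "encode_state = (\<lambda>(N, t, x, K).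
     prod_encode (N, prod_encode (t, prod_encode (x, set_encode (prod_encode ` K)))))"

definition decode_state :: "nat \<Rightarrow> nat \<times> nat \<times> nat \<times> nat rel" where
  "decode_state s =
     (let (N, s1) = prod_decode s; (t, s2) = prod_decode s1; (x, k) = prod_decode s2
      in (N, t, x, prod_decode ` set_decode k))"

definition known :: "nat \<Rightarrow> nat rel" where
  "known s = snd (snd (snd (decode_state s)))"

text \<open>The heads of known arcs may lie one step outside the ball gathered so far; the
  restriction to \<open>Domain K\<close> leaves the graph induced by that ball. Testing
  \<open>t = r N\<close> is enough because decided nodes are frozen.\<close>

definition gather_algorithm ::
    "(nat \<Rightarrow> nat) \<Rightarrow> (nat \<Rightarrow> nat rel \<Rightarrow> nat \<Rightarrow> nat) \<Rightarrow> (nat, nat) local_algorithm" where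
  "gather_algorithm r F =
     \<lparr>init_state = \<lambda>N x X. encode_state (N, 0, x, {x} \<times> insert x X),
      message = \<lambda>s y. Some s,
      update = \<lambda>s m. case decode_state s of (N, t, x, K) \<Rightarrow>
        encode_state (N, Suc t, x, K \<union> (\<Union>s'\<in>ran m. known s')),
      decision = \<lambda>s. case decode_state s of (N, t, x, K) \<Rightarrow>
        if t = r N then Some (F N (Restr K (Domain K)) x) else None\<rparr>"

lemma decode_encode_state [simp]:
  "finite K \<Longrightarrow> decode_state (encode_state (N, t, x, K)) = (N, t, x, K)"
  by (simp add: decode_state_def encode_state_def image_image)

lemma known_encode_state [simp]: "finite K \<Longrightarrow> known (encode_state (N, t, x, K)) = K"
  by (simp add: known_def)

lemma gather_algorithm_simps:
  "message (gather_algorithm r F) s y = Some s"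
  "finite K \<Longrightarrow> update (gather_algorithm r F) (encode_state (N, t, x, K)) m =
     encode_state (N, Suc t, x, K \<union> (\<Union>s'\<in>ran m. known s'))"
  "finite K \<Longrightarrow> decision (gather_algorithm r F) (encode_state (N, t, x, K)) =
     (if t = r N then Some (F N (Restr K (Domain K)) x) else None)"
  by (simp_all add: gather_algorithm_def)

lemma run_decided:
  assumes "decision A (run A G ident N t v) \<noteq> None"
  shows "run A G ident N (t + j) v = run A G ident N t v"
  using assms by (induction j) (auto simp: Let_def)

section \<open>Knowledge spreads by one hop per round\<close>

context
  fixes G :: "'a pair_pre_digraph" and ident :: "'a \<Rightarrow> nat"
  assumes G: "pair_graph G" and inj: "inj_on ident (pverts G)"
begin

interpretation pair_graph G by (rule G)

lemma arc_verts: "(u, v) \<in> parcs G \<Longrightarrow> u \<in> pverts G \<and> v \<in> pverts G"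
  by (rule conjI; erule wellformed')

lemma Field_id_graph: "Field (id_graph G ident) = ident ` pverts G"
  by (auto simp: id_graph_def Field_def Domain_iff Range_iff)

lemma id_graph_iff:
  assumes "u \<in> pverts G" "v \<in> pverts G"
  shows "(ident u, ident v) \<in> id_graph G ident \<longleftrightarrow> u = v \<or> (u, v) \<in> parcs G"
  using assms inj unfolding id_graph_def by (auto dest: inj_onD)

lemma fgraph_id_graph: "fgraph (id_graph G ident)"
  unfolding fgraph_def
proof (intro conjI)
  have "id_graph G ident \<subseteq> ident ` pverts G \<times> ident ` pverts G"
    by (auto simp: id_graph_def)
  then show "finite (id_graph G ident)"
    by (rule finite_subset) (simp add: pair_finite_verts)
  have "(v, u) \<in> parcs G" if "(u, v) \<in> parcs G" for u v
    using that pair_sym_arcs by (auto simp: symmetric_def dest: symD)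
  then show "sym (id_graph G ident)"
    by (auto simp: id_graph_def sym_def)
  show "\<forall>x\<in>Field (id_graph G ident). (x, x) \<in> id_graph G ident"
    unfolding Field_id_graph by (auto simp: id_graph_iff)
qed

definition knowledge :: "nat \<Rightarrow> 'a \<Rightarrow> nat rel" where
  "knowledge t v = {(x, y) \<in> id_graph G ident. (ident v, x) \<in> id_graph G ident ^^ t}"

lemma finite_knowledge: "finite (knowledge t v)"
  using fgraph_finite[OF fgraph_id_graph]
  by (rule finite_subset[rotated]) (auto simp: knowledge_def)

lemma knowledge_0:
  assumes "v \<in> pverts G"
  shows "knowledge 0 v = {ident v} \<times> insert (ident v) (ident ` neighbors G v)"
  using assms id_graph_iff[OF assms] arc_verts
  by (auto simp: knowledge_def neighbors_def id_graph_def dest: inj_onD[OF inj])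

text \<open>A walk is split after its first step, which is the loop at \<open>v\<close> or leads to
  a neighbor.\<close>

lemma knowledge_Suc:
  assumes v: "v \<in> pverts G"
  shows "knowledge (Suc t) v = knowledge t v \<union> (\<Union>u\<in>neighbors G v. knowledge t u)"
proof -
  have "(ident v, x) \<in> id_graph G ident ^^ Suc t \<longleftrightarrow>
      (\<exists>u\<in>insert v (neighbors G v). (ident u, x) \<in> id_graph G ident ^^ t)" for x
  proof
    assume "(ident v, x) \<in> id_graph G ident ^^ Suc t"
    then obtain z where z: "(ident v, z) \<in> id_graph G ident" "(z, x) \<in> id_graph G ident ^^ t"
      by (meson relpow_Suc_D2)
    then obtain u where u: "u \<in> pverts G" "z = ident u" using Field_id_graph by (force simp: Field_def)
    with z v show "\<exists>u\<in>insert v (neighbors G v). (ident u, x) \<in> id_graph G ident ^^ t"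
      by (auto simp: id_graph_iff neighbors_def)
  next
    assume "\<exists>u\<in>insert v (neighbors G v). (ident u, x) \<in> id_graph G ident ^^ t"
    then obtain u where u: "u = v \<or> (v, u) \<in> parcs G" "(ident u, x) \<in> id_graph G ident ^^ t"
      by (auto simp: neighbors_def)
    then have "(ident v, ident u) \<in> id_graph G ident"
      using v arc_verts id_graph_iff by blast
    with u(2) show "(ident v, x) \<in> id_graph G ident ^^ Suc t" by (rule relpow_Suc_I2[rotated])
  qed
  then show ?thesis unfolding knowledge_def by (auto simp del: relpow.simps)
qed

lemma run_gather:
  assumes "t \<le> r N" "v \<in> pverts G"
  shows "run (gather_algorithm r F) G ident N t v = encode_state (N, t, ident v, knowledge t v)"
  using assms
proof (induction t arbitrary: v)
  case 0
  then show ?case by (simp add: gather_algorithm_def knowledge_0)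
next
  case (Suc t)
  let ?A = "gather_algorithm r F"
  let ?\<sigma> = "run ?A G ident N t"
  have \<sigma>: "?\<sigma> u = encode_state (N, t, ident u, knowledge t u)" if "u \<in> pverts G" for u
    using Suc.IH[OF _ that] Suc.prems by simp
  \<comment> \<open>Nobody stops before round \<open>r N\<close>, so no message is
    suppressed.\<close>
  have undecided: "decision ?A (?\<sigma> u) = None" if "u \<in> pverts G" for u
    unfolding \<sigma>[OF that] using Suc.prems by (simp add: gather_algorithm_simps finite_knowledge)
  have nb: "neighbors G v \<subseteq> pverts G" using arc_verts by (auto simp: neighbors_def)
  have inv: "the_inv_into (neighbors G v) ident (ident u) = u" if "u \<in> neighbors G v" for u
    using that nb inj by (meson inj_on_subset the_inv_into_f_f)
  have "inbox ?A G ident ?\<sigma> v =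
      (\<lambda>y. if y \<in> ident ` neighbors G v
           then Some (?\<sigma> (the_inv_into (neighbors G v) ident y)) else None)"
    using inv nb undecided by (auto simp: inbox_def fun_eq_iff Let_def gather_algorithm_simps)
  then have "ran (inbox ?A G ident ?\<sigma> v) = ?\<sigma> ` neighbors G v"
    using inv by (auto simp: ran_def image_def split: if_splits) metis+
  moreover have "known (?\<sigma> u) = knowledge t u" if "u \<in> neighbors G v" for u
    using \<sigma>[of u] nb that finite_knowledge by auto
  ultimately have "(\<Union>s'\<in>ran (inbox ?A G ident ?\<sigma> v). known s') =
      (\<Union>u\<in>neighbors G v. knowledge t u)" by simp
  then show ?case
    using undecided[OF Suc.prems(2)] \<sigma>[OF Suc.prems(2)] Suc.prems(2)
    by (simp add: Let_def gather_algorithm_simps finite_knowledge knowledge_Suc)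
qed

lemma computes_gather:
  assumes "r N \<le> T"
  shows "computes_within (gather_algorithm r F) G ident N T
    (\<lambda>v. F N (Restr (id_graph G ident) ((id_graph G ident ^^ r N) `` {ident v})) (ident v))"
  unfolding computes_within_def
proof
  fix v assume v: "v \<in> pverts G"
  let ?A = "gather_algorithm r F" and ?R = "id_graph G ident" and ?K = "knowledge (r N) v"
  have run: "run ?A G ident N (r N) v = encode_state (N, r N, ident v, ?K)"
    by (rule run_gather[OF order_refl v])
  have "Domain ?K = (?R ^^ r N) `` {ident v}"
  proof -
    have "ident v \<in> Field ?R" using v Field_id_graph by simp
    then show ?thesis
      using fgraph_refl[OF fgraph_id_graph] relpow_Field[of "ident v" _ "r N" ?R]
      by (auto simp: knowledge_def Domain_iff)
  qed
  then have "Restr ?K (Domain ?K) = Restr ?R ((?R ^^ r N) `` {ident v})"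
    by (auto simp: knowledge_def)
  then have dec: "decision ?A (run ?A G ident N (r N) v) =
      Some (F N (Restr ?R ((?R ^^ r N) `` {ident v})) (ident v))"
    unfolding run by (simp add: gather_algorithm_simps finite_knowledge)
  with run_decided[of ?A G ident N "r N" v "T - r N"] assms
  show "decision ?A (run ?A G ident N T v) =
      Some (F N (Restr ?R ((?R ^^ r N) `` {ident v})) (ident v))" by simp
qed

text \<open>Identifiers are injective, so connectivity and walks transfer between a color class and
  its image. Distance is the least cost of a walk with unit weights, so exhibiting a walk with at
  most \<open>d\<close> arcs suffices.\<close>

lemma network_decompositionI:
  assumes range: "\<And>v. v \<in> pverts G \<Longrightarrow> col (ident v) \<in> {1..c}"
    and comp: "\<And>i. 1 \<le> i \<Longrightarrow> i \<le> c \<Longrightarrow>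
      components_within d (id_graph G ident) {x \<in> Field (id_graph G ident). col x = i}"
  shows "network_decomposition G c d (\<lambda>v. col (ident v))"
  unfolding network_decomposition_def
proof (intro conjI ballI)
  show "(\<lambda>v. col (ident v)) ` pverts G \<subseteq> {1..c}" using range by auto
next
  fix i U
  define X where "X = color_class G (\<lambda>v. col (ident v)) i"
  define H where "H = with_proj G \<restriction> X"
  define M where "M = {x \<in> Field (id_graph G ident). col x = i}"
  let ?P = "Restr (id_graph G ident) M"
  assume i: "i \<in> {1..c}"
    and "U \<in> pre_digraph.sccs_verts (with_proj G \<restriction> color_class G (\<lambda>v. col (ident v)) i)"
  then have U: "U \<in> pre_digraph.sccs_verts H" by (simp add: H_def X_def)
  interpret H: wf_digraph H unfolding H_def ..
  have X: "v \<in> X \<longleftrightarrow> v \<in> pverts G \<and> col (ident v) = i" for v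
    by (simp add: X_def color_class_def)
  have XM: "ident v \<in> M \<longleftrightarrow> v \<in> X" if "v \<in> pverts G" for v
    using that by (auto simp: M_def Field_id_graph X)
  have arc: "(u, v) \<in> arcs H \<longleftrightarrow> (u, v) \<in> parcs G \<and> u \<in> X \<and> v \<in> X" for u v
    by (simp add: H_def)
  have tail_head: "tail H = fst" "head H = snd" by (simp_all add: H_def)
  have ends: "arcs_ends H = arcs H"
    by (auto simp: H_def arcs_ends_def arc_to_ends_def)
  have reach: "(ident u, ident v) \<in> ?P\<^sup>+" if "u \<rightarrow>\<^sup>*\<^bsub>H\<^esub> v" for u v
    using that unfolding reachable_def
  proof (induction rule: rtrancl_on_induct)
    case base
    then have "u \<in> X" by (simp add: H_def)
    then show ?case using X XM id_graph_iff by (intro r_into_trancl) auto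
  next
    case (step y z)
    then have "(y, z) \<in> parcs G" "y \<in> X" "z \<in> X" by (simp_all add: ends arc)
    then have "(ident y, ident z) \<in> ?P" using X XM id_graph_iff by auto
    with step.IH show ?case by (rule trancl_into_trancl)
  qed
  have walk: "\<exists>p. H.awalk u p v \<and> length p \<le> k"
    if "u \<in> X" "v \<in> X" "(ident u, ident v) \<in> ?P ^^ k" for u v k
    using that
  proof (induction k arbitrary: u)
    case 0
    then have "u = v" using X by (auto dest: inj_onD[OF inj])
    moreover have "u \<in> verts H" using 0 by (simp add: H_def)
    ultimately show ?case by (intro exI[of _ "[]"]) (simp add: H.awalk_Nil_iff)
  next
    case (Suc k)
    from Suc.prems(3) obtain z where z: "(ident u, z) \<in> ?P" "(z, ident v) \<in> ?P ^^ k"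
      by (meson relpow_Suc_D2)
    then obtain w where w: "w \<in> pverts G" "z = ident w"
      by (auto simp: M_def Field_id_graph)
    with z have wX: "w \<in> X" using XM by auto
    from Suc.IH[OF wX Suc.prems(2)] z w obtain p where p: "H.awalk w p v" "length p \<le> k" by auto
    show ?case
    \<comment> \<open>Loop steps are dropped, whence length at most \<open>k\<close> instead of
      equal to \<open>k\<close>.\<close>
    proof (cases "u = w")
      case True
      with p show ?thesis by (auto intro: le_SucI)
    next
      case False
      with z w Suc.prems X have "(u, w) \<in> parcs G" using id_graph_iff by auto
      with wX Suc.prems have "(u, w) \<in> arcs H" by (simp add: arc)
      with p have "H.awalk u ((u, w) # p) v"
        by (simp add: H.awalk_Cons_iff tail_head)
      with p(2) show ?thesis by (intro exI[of _ "(u, w) # p"]) simp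
    qed
  qed
  have "H.\<mu> (\<lambda>_. 1) u v \<le> ereal (real d)" if uv: "u \<in> U" "v \<in> U" for u v
  proof -
    from U uv have r: "u \<rightarrow>\<^sup>*\<^bsub>H\<^esub> v" by (auto simp: H.in_sccs_verts_conv_reachable)
    then have "u \<in> X" "v \<in> X"
      using H.reachable_in_verts by (auto simp: H_def)
    moreover have "(ident u, ident v) \<in> ?P ^^ d"
      using reach[OF r] comp[of i] i by (auto simp: components_within_def M_def)
    ultimately obtain p where p: "H.awalk u p v" "length p \<le> d" using walk by blast
    have "H.awalk_cost (\<lambda>_. 1) p = real (length p)"
      by (induction p) auto
    with H.min_cost_le_walk_cost[OF p(1), of "\<lambda>_. 1"] p(2) show ?thesis
      by (metis ereal_less_eq(3) of_nat_le_iff order_trans)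
  qed
  then show "diameter_in (with_proj G \<restriction> color_class G (\<lambda>v. col (ident v)) i) U \<le> ereal (real d)"
    unfolding diameter_in_def H_def[symmetric] X_def[symmetric] by (auto intro!: SUP_least)
qed

end

section \<open>Round complexity\<close>

definition bit_length :: "nat \<Rightarrow> nat" where
  "bit_length N = (LEAST l. N < 2 ^ l)"

lemma less_bit_length: "N < 2 ^ bit_length N"
  unfolding bit_length_def by (rule LeastI_ex) (use less_exp in blast)

lemma bit_length_le: "N < 2 ^ l \<Longrightarrow> bit_length N \<le> l"
  unfolding bit_length_def by (rule Least_le)

lemma bit_length_mono: "M \<le> N \<Longrightarrow> bit_length M \<le> bit_length N"
  using less_bit_length[of N] by (intro bit_length_le) simp

text \<open>Nodes know only \<open>N\<close>, so the identifier length is maximized over all admissible \<open>n\<close>.\<close>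

definition id_bits :: "(nat \<Rightarrow> nat) \<Rightarrow> nat \<Rightarrow> nat" where
  "id_bits b N = Max (insert 1 (b ` {..N}))"

lemma id_bits_ge: "n \<le> N \<Longrightarrow> b n \<le> id_bits b N" "1 \<le> id_bits b N"
  unfolding id_bits_def by (rule Max_ge; simp)+

lemma id_bits_mono: "M \<le> N \<Longrightarrow> id_bits b M \<le> id_bits b N"
  unfolding id_bits_def by (rule Max_mono) auto

lemma color_radius_mono:
  "b \<le> b' \<Longrightarrow> L \<le> L' \<Longrightarrow> color_radius b L \<le> color_radius b' L'"
  unfolding color_radius_def Let_def carve_steps_def
  by (intro Suc_le_mono[THEN iffD2] mult_le_mono add_le_mono order_refl)

text \<open>With \<open>T = 2 * b\<^sup>2 * L\<close> the radius for one color is at most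
  \<open>25 * L * T\<^sup>2\<close>, and the number of colors contributes \<open>3 * L\<close>;
  \<open>300 = 3 * 25 * 4\<close>.\<close>

lemma rounds_le:
  assumes "0 < b" shows "3 * L * color_radius b L \<le> 300 * (L ^ 4 * b ^ 4)"
proof (cases "L = 0")
  case True
  then show ?thesis by simp
next
  case False
  define T where "T = carve_steps b L"
  have T: "1 \<le> T" "T = 2 * b\<^sup>2 * L"
    using assms False by (auto simp: T_def carve_steps_def power2_eq_square)
  have T2: "T \<le> T\<^sup>2" "1 \<le> T\<^sup>2" using T(1) by (auto simp: power2_eq_square)
  have "T * (2 * T + 1) + (2 * T + 3) = 2 * T\<^sup>2 + 3 * T + 3"
    by (simp add: power2_eq_square algebra_simps)
  also have "\<dots> \<le> 8 * T\<^sup>2" using T2 by simp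
  finally have "(2 * L + 1) * (T * (2 * T + 1) + (2 * T + 3)) \<le> (3 * L) * (8 * T\<^sup>2)"
    using False by (intro mult_le_mono) auto
  then have "color_radius b L \<le> 1 + 24 * (L * T\<^sup>2)"
    by (simp only: color_radius_def Let_def T_def)
  also have "\<dots> \<le> 25 * (L * T\<^sup>2)" using False T by simp
  finally have "3 * L * color_radius b L \<le> 3 * L * (25 * (L * T\<^sup>2))" by simp
  also have "\<dots> = 300 * (L ^ 4 * b ^ 4)" unfolding T(2) by (simp add: power2_eq_square power4_eq_xxxx ac_simps)
  finally show ?thesis .
qed

text \<open>A polynomial inside a logarithm only changes constants. The bound on \<open>g\<close> is
  required at every \<open>x\<close> above \<open>N\<close>, so that \<open>C' * n ^ k\<close> can
  be inserted without monotonicity of \<open>g\<close>, even where \<open>p n\<close> is 0.\<close>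

lemma log_of_poly_bound:
  fixes g p :: "nat \<Rightarrow> nat"
  assumes g: "\<And>N x. 1 \<le> x \<Longrightarrow> real N \<le> x \<Longrightarrow> real (g N) \<le> a + c * ln x"
    and c: "0 \<le> c" and p: "(\<lambda>n. real (p n)) \<in> O(\<lambda>n. real n ^ k)"
  shows "(\<lambda>n. real (g (p n))) \<in> O(\<lambda>n. ln (real n))"
proof -
  from p obtain C where C: "\<forall>\<^sub>F n in sequentially. norm (real (p n)) \<le> C * norm (real n ^ k)"
    by (elim landau_o.bigE)
  define C' where "C' = max 1 C"
  have "\<forall>\<^sub>F n in sequentially. norm (real (g (p n))) \<le> (\<bar>a\<bar> + c * (ln C' + k)) * norm (ln (real n))"
    using C eventually_ge_at_top[of 3]
  proof eventually_elim
    case (elim n)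
    \<comment> \<open>From \<open>n \<ge> 3 \<ge> exp 1\<close>; it lets the additive constants be
      absorbed into multiples of the logarithm.\<close>
    have ln1: "1 \<le> ln (real n)"
    proof -
      have "exp 1 \<le> real n" using exp_le elim(2) by linarith
      then show ?thesis using elim(2) by (subst ln_ge_iff) auto
    qed
    have "C * real n ^ k \<le> C' * real n ^ k" by (rule mult_right_mono) (auto simp: C'_def)
    with elim(1) have le: "real (p n) \<le> C' * real n ^ k" by (auto elim: order_trans)
    have "1 \<le> C'" "1 \<le> real n ^ k" using elim(2) by (auto simp: C'_def)
    then have 1: "1 \<le> C' * real n ^ k" using mult_mono[of 1 C' 1 "real n ^ k"] by simp
    have lnC: "0 \<le> ln C'" using \<open>1 \<le> C'\<close> by simp
    have "real (g (p n)) \<le> a + c * ln (C' * real n ^ k)" by (rule g[OF 1 le])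
    also have "ln (C' * real n ^ k) = ln C' + k * ln (real n)"
      using \<open>1 \<le> C'\<close> elim(2) by (simp add: ln_mult ln_realpow)
    also have "a + c * (ln C' + k * ln (real n)) \<le>
        \<bar>a\<bar> * ln (real n) + c * (ln C' * ln (real n) + k * ln (real n))"
    proof (intro add_mono mult_left_mono c)
      show "a \<le> \<bar>a\<bar> * ln (real n)" using mult_left_mono[OF ln1, of "\<bar>a\<bar>"] by linarith
      show "ln C' \<le> ln C' * ln (real n)" using mult_left_mono[OF ln1 lnC] by simp
    qed simp_all
    finally show ?case using ln1 by (simp add: algebra_simps)
  qed
  then show ?thesis by (rule bigoI)
qed

lemma bit_length_bigo:
  assumes "(\<lambda>n. real (p n)) \<in> O(\<lambda>n. real n ^ k)"
  shows "(\<lambda>n. real (bit_length (p n))) \<in> O(\<lambda>n. ln (real n))"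
proof (rule log_of_poly_bound[OF _ _ assms])
  fix N :: nat and x :: real assume x: "1 \<le> x" "real N \<le> x"
  define l where "l = nat \<lfloor>log 2 x\<rfloor> + 1"
  have l0: "0 \<le> log 2 x" using x by simp
  have "log 2 x < real l" using l0 by (simp add: l_def) linarith
  then have "x < 2 powr l" using x by (subst (asm) log_less_iff) auto
  then have "x < real (2 ^ l)" by (simp add: powr_realpow)
  with x have "real N < real (2 ^ l)" by linarith
  then have "bit_length N \<le> l" by (intro bit_length_le) (simp only: of_nat_less_iff)
  also have "real l \<le> 1 + log 2 x" using l0 by (simp add: l_def)
  finally show "real (bit_length N) \<le> 1 + (1 / ln 2) * ln x" by (simp add: log_def)
qed simp

lemma id_bits_bigo:
  assumes b: "(\<lambda>n. real (b n)) \<in> O(\<lambda>n. ln (real n))"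
    and p: "(\<lambda>n. real (p n)) \<in> O(\<lambda>n. real n ^ k)"
  shows "(\<lambda>n. real (id_bits b (p n))) \<in> O(\<lambda>n. ln (real n))"
proof -
  from b obtain c where c: "c > 0"
    "\<forall>\<^sub>F n in sequentially. norm (real (b n)) \<le> c * norm (ln (real n))"
    by (elim landau_o.bigE)
  then obtain m0 where m0: "\<And>m. m \<ge> m0 \<Longrightarrow> real (b m) \<le> c * \<bar>ln (real m)\<bar>"
    by (auto simp: eventually_at_top_linorder)
  \<comment> \<open>Absorbs the finitely many arguments at which the asymptotic bound on
    \<open>b\<close> need not hold yet.\<close>
  define D where "D = (\<Sum>m\<le>m0. b m)"
  have "real (id_bits b N) \<le> (1 + real D) + c * ln x" if x: "1 \<le> x" "real N \<le> x" for N x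
  proof -
    have "id_bits b N \<in> insert 1 (b ` {..N})" unfolding id_bits_def by (rule Max_in) auto
    then consider "id_bits b N = 1" | m where "m \<le> N" "id_bits b N = b m" by auto
    then show ?thesis
    proof cases
      case 1
      with x c show ?thesis by simp
    next
      case 2
      show ?thesis
      proof (cases "m \<le> m0")
        case True
        then have "b m \<le> D" unfolding D_def by (intro member_le_sum) auto
        moreover have "0 \<le> c * ln x" using x c by simp
        ultimately show ?thesis using 2 by simp
      next
        case False
        then have m: "1 \<le> real m" "m0 \<le> m" by auto
        then have "real (b m) \<le> c * ln (real m)" using m0[of m] by simp
        also have "\<dots> \<le> c * ln x" using c m 2 x by (intro mult_left_mono) auto
        finally show ?thesis using 2 by simp
      qed
    qed
  qed
  from log_of_poly_bound[OF this _ p] c show ?thesis by simp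
qed

theorem theorem2p14:
  fixes b p :: "nat \<Rightarrow> nat" and k :: nat
  assumes "(\<lambda>n. real (b n)) \<in> O(\<lambda>n. ln (real n))"
    and "(\<lambda>n. real (p n)) \<in> O(\<lambda>n. real n ^ k)"
  shows "\<exists>(A :: (nat, nat) local_algorithm) (c :: nat \<Rightarrow> nat) (d :: nat \<Rightarrow> nat) (T :: nat \<Rightarrow> nat).
    (\<lambda>n. real (c n)) \<in> O(\<lambda>n. ln (real n)) \<and>
    (\<lambda>n. real (d n)) \<in> O(\<lambda>n. ln (real n)) \<and>
    (\<lambda>n. real (T n)) \<in> O(\<lambda>n. ln (real n) ^ 8) \<and>
    (\<forall>(G :: 'a pair_pre_digraph) (ident :: 'a \<Rightarrow> nat) (n :: nat) (N :: nat).
       pair_graph G \<and> card (pverts G) = n \<and> bit_identifiers G (b n) ident \<and> n \<le> N \<and> N \<le> p n \<longrightarrow>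
       (\<exists>f. computes_within A G ident N (T n) f \<and> network_decomposition G (c n) (d n) f))"
proof -
  \<comment> \<open>The algorithm works with \<open>L N\<close> and \<open>B N\<close>, as nodes
    know only \<open>N\<close>; the bounds in terms of \<open>n\<close> use \<open>p n\<close>,
    which dominates \<open>N\<close>, by monotonicity.\<close>
  define L where "L = bit_length"
  define B where "B = id_bits b"
  define r where "r N = 3 * L N * color_radius (B N) (L N)" for N
  define F where "F N = node_color (B N) (L N)" for N
  have L: "(\<lambda>n. real (L (p n))) \<in> O(\<lambda>n. ln (real n))"
    unfolding L_def by (rule bit_length_bigo[OF assms(2)])
  have B: "(\<lambda>n. real (B (p n))) \<in> O(\<lambda>n. ln (real n))"
    unfolding B_def by (rule id_bits_bigo[OF assms])
  have "(\<lambda>n. real (L (p n)) ^ 4 * real (B (p n)) ^ 4) \<in> O(\<lambda>n. ln (real n) ^ 4 * ln (real n) ^ 4)"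
    by (intro landau_o.big.mult landau_o.big_power L B)
  also have "(\<lambda>n. ln (real n) ^ 4 * ln (real n) ^ 4) = (\<lambda>n. ln (real n) ^ 8)"
    by (simp flip: power_add)
  finally have LB: "(\<lambda>n. real (L (p n)) ^ 4 * real (B (p n)) ^ 4) \<in> O(\<lambda>n. ln (real n) ^ 8)" .
  have B0: "0 < B N" for N using id_bits_ge(2)[where b = b] by (simp add: B_def Suc_le_eq)
  have "(\<lambda>n. real (r (p n))) \<in> O(\<lambda>n. real (L (p n)) ^ 4 * real (B (p n)) ^ 4)"
  proof (rule landau_o.bigI[of 300])
    have "real (r N) \<le> 300 * (real (L N) ^ 4 * real (B N) ^ 4)" for N
      using of_nat_mono[OF rounds_le[OF B0[of N], of "L N"], where 'a = real] by (simp add: r_def)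
    then show "\<forall>\<^sub>F n in sequentially. norm (real (r (p n))) \<le>
        300 * norm (real (L (p n)) ^ 4 * real (B (p n)) ^ 4)" by simp
  qed simp
  from this LB have T: "(\<lambda>n. real (r (p n))) \<in> O(\<lambda>n. ln (real n) ^ 8)"
    by (rule landau_o.big_trans)
  show ?thesis
  proof (rule exI[of _ "gather_algorithm r F"], rule exI[of _ "\<lambda>n. 3 * L (p n)"],
      rule exI[of _ "\<lambda>n. 2 * L (p n)"], rule exI[of _ "\<lambda>n. r (p n)"], intro conjI allI impI)
    show "(\<lambda>n. real (3 * L (p n))) \<in> O(\<lambda>n. ln (real n))"
      "(\<lambda>n. real (2 * L (p n))) \<in> O(\<lambda>n. ln (real n))" using L by simp_all
    show "(\<lambda>n. real (r (p n))) \<in> O(\<lambda>n. ln (real n) ^ 8)" by (rule T)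
  next
    fix G :: "'a pair_pre_digraph" and ident :: "'a \<Rightarrow> nat" and n N :: nat
    assume *: "pair_graph G \<and> card (pverts G) = n \<and> bit_identifiers G (b n) ident \<and> n \<le> N \<and> N \<le> p n"
    then have G: "pair_graph G" and inj: "inj_on ident (pverts G)"
      and ids: "\<And>v. v \<in> pverts G \<Longrightarrow> ident v < 2 ^ b n" and nN: "n \<le> N" and Np: "N \<le> p n"
      by (auto simp: bit_identifiers_def)
    let ?R = "id_graph G ident" and ?A = "gather_algorithm r F"
    define f where "f v = F N ?R (ident v)" for v
    note R = fgraph_id_graph[OF G inj]
    have FR: "Field ?R = ident ` pverts G" by (rule Field_id_graph[OF G inj])
    have LN: "L N \<le> L (p n)" and BN: "B N \<le> B (p n)"
      using Np by (simp_all add: L_def B_def bit_length_mono id_bits_mono)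
    have card: "card (Field ?R) < 2 ^ L N"
      using less_bit_length[of N] * nN card_image[OF inj] by (simp add: FR L_def)
    have "(2::nat) ^ b n \<le> 2 ^ B N"
      using id_bits_ge(1)[OF nN] by (intro power_increasing) (auto simp: B_def)
    with ids have "Field ?R \<subseteq> {..<2 ^ B N}"
      unfolding FR lessThan_def by (blast intro: less_le_trans)
    note node_color = node_color_range[OF R B0[of N] card this, folded F_def]
      node_color_components[OF R B0[of N] card this, folded F_def]
    have "network_decomposition G (3 * L (p n)) (2 * L (p n)) f"
      unfolding f_def
    proof (rule network_decompositionI[OF G inj])
      show "F N ?R (ident v) \<in> {1..3 * L (p n)}" if "v \<in> pverts G" for v
        using node_color(1)[of "ident v"] that LN by (auto simp: FR)
    next
      fix i :: nat assume "1 \<le> i"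
      show "components_within (2 * L (p n)) ?R {x \<in> Field ?R. F N ?R x = i}"
      proof (cases "i \<le> 3 * L N")
        case True
        show ?thesis
          by (rule components_within_mono[OF R node_color(2)[OF \<open>1 \<le> i\<close> True]]) (use LN in simp)
      next
        case False
        \<comment> \<open>Colors above \<open>3 * L N\<close> are allowed by the bound in
          \<open>p n\<close> but have empty classes.\<close>
        then have "{x \<in> Field ?R. F N ?R x = i} = {}" using node_color(1) by fastforce
        then show ?thesis by (simp only: components_within_def) simp
      qed
    qed
    moreover have "computes_within ?A G ident N (r (p n)) f"
      unfolding computes_within_def
    proof
      fix v assume v: "v \<in> pverts G"
      have "r N \<le> r (p n)"
        unfolding r_def using LN BN by (intro mult_le_mono color_radius_mono order_refl)
      note run = computes_gather[where r = r and F = F, OF G inj this, unfolded computes_within_def,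
          rule_format, OF v]
      let ?W = "(?R ^^ r N) `` {ident v}"
      \<comment> \<open>\<open>r N\<close> was chosen as the dependency radius of the color, so the
        gathered ball determines it.\<close>
      have "deep ?R ?W (3 * L N * color_radius (B N) (L N)) (ident v)"
        using v by (auto simp: deep_def FR r_def)
      from node_color_local[OF R this] have "F N (Restr ?R ?W) (ident v) = f v"
        by (simp add: F_def f_def)
      with run show "decision ?A (run ?A G ident N (r (p n)) v) = Some (f v)" by simp
    qed
    ultimately show "\<exists>f. computes_within ?A G ident N (r (p n)) f \<and>
        network_decomposition G (3 * L (p n)) (2 * L (p n)) f" by blast
  qed
qed

end
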